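(* Consider a nonconfluent parallel IMEX GLM with $\mathbf{U}=\mathbf{I}_{s\times s}$ (so $r=s$), i.e. an IMEX general linear method with $s$ internal and $r=s$ external stages, distinct abscissae $c_1,\dots,c_s$, and coefficients $\mathbf{A}=\mathbf{0}_{s\times s}$, $\widehat{\mathbf{A}}=\lambda\,\mathbf{I}_{s\times s}$ with $\lambda>0$, $\mathbf{U}=\mathbf{I}_{s\times s}$, and $\mathbf{B},\widehat{\mathbf{B}},\mathbf{V}\in\mathbb{R}^{s\times s}$, with external stage weights $\mathbf{W},\widehat{\mathbf{W}}$. All of the following are equivalent: 1. The (IMEX) method satisfies $p=q=r=s$, i.e. it has order $p=s$ and stage order $q=s$. 2. The explicit base method satisfies $p=q=r=s$ and $$\widehat{\mathbf{W}}=\mathbf{C}_{s+1}-\lambda\,\mathbf{C}_{s+1}\,\mathbf{K}_{s+1},\qquad \widehat{\mathbf{B}}=\mathbf{B}-\lambda\,\mathbf{C}_s\,\mathbf{E}_s\,\mathbf{C}_s^{-1}+\lambda\,\mathbf{V}.$$ 3. The implicit base method satisfies $p=q=r=s$ and $$\mathbf{W}=\mathbf{C}_{s+1},\qquad \mathbf{B}=\widehat{\mathbf{B}}+\lambda\,\mathbf{C}_s\,\mathbf{E}_s\,\mathbf{C}_s^{-1}-\lambda\,\mathbf{V}.$$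
   Context: Setting: the autonomous ODE $y'=f(y)+g(y)$, $y(t)\in\mathbb{R}^d$, with $f,g$ sufficiently smooth. An IMEX general linear method (IMEX GLM) with $s$ internal stages $Y_i$, $r$ external stages $y^{[n]}_i$, timestep $h$, abscissae $\mathbf{c}=(c_1,\dots,c_s)^T\in\mathbb{R}^s$ and coefficient matrices $\mathbf{A}=(a_{i,j})$ (strictly lower triangular) and $\widehat{\mathbf{A}}=(\widehat a_{i,j})$ (lower triangular) in $\mathbb{R}^{s\times s}$, $\mathbf{B}=(b_{i,j}),\widehat{\mathbf{B}}=(\widehat b_{i,j})\in\mathbb{R}^{r\times s}$, $\mathbf{U}=(u_{i,j})\in\mathbb{R}^{s\times r}$, $\mathbf{V}=(v_{i,j})\in\mathbb{R}^{r\times r}$ is $$Y_i=h\sum_{j=1}^{i-1}a_{i,j}f(Y_j)+h\sum_{j=1}^{i}\widehat a_{i,j}g(Y_j)+\sum_{j=1}^r u_{i,j}y^{[n-1]}_j,\quad i=1,\dots,s,$$ $$y^{[n]}_i=h\sum_{j=1}^s\left(b_{i,j}f(Y_j)+\widehat b_{i,j}g(Y_j)\right)+\sum_{j=1}^r v_{i,j}y^{[n-1]}_j,\quad i=1,\dots,r.$$ It is called parallel if $\mathbf{A}=\mathbf{0}$ and $\widehat{\mathbf{A}}=\lambda\mathbf{I}$ with $\lambda>0$, and nonconfluent if the $c_i$ are distinct. The explicit base method is the GLM with coefficients $(\mathbf{c},\mathbf{A},\mathbf{B},\mathbf{U},\mathbf{V})$ and weights $\mathbf{W}$; the implicit base method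 is the GLM with coefficients $(\mathbf{c},\widehat{\mathbf{A}},\widehat{\mathbf{B}},\mathbf{U},\mathbf{V})$ and weights $\widehat{\mathbf{W}}$. Order. The external stage weights are matrices $\mathbf{W}=(w_{i,k}),\widehat{\mathbf{W}}=(\widehat w_{i,k})\in\mathbb{R}^{r\times(p+1)}$, $k=0,\dots,p$, with $w_{i,0}=\widehat w_{i,0}$. Assume the incoming external stages satisfy $$y^{[n-1]}_i=w_{i,0}\,y(t_{n-1})+\sum_{k=1}^p w_{i,k}h^k\frac{d^{k-1}f(y(t))}{dt^{k-1}}(t_{n-1})+\sum_{k=1}^p\widehat w_{i,k}h^k\frac{d^{k-1}g(y(t))}{dt^{k-1}}(t_{n-1})+O(h^{p+1}).$$ The method has stage order $q$ if $Y_i=y(t_{n-1}+c_ih)+O(h^{q+1})$ for all $i$, and order $p$ if $y^{[n]}_i$ satisfies the same expansion with $t_{n-1}$ replaced by $t_n=t_{n-1}+h$. The base methods' orders are defined in the same way, for $y'=f(y)$ (weights $\mathbf{W}$) and $y'=g(y)$ (weights $\widehat{\mathbf{W}}$) respectively. Notation. $\mathbf{K}_n\in\mathbb{R}^{n\times n}$ has ones on the first superdiagonal and zeros elsewhere; $\mathbf{E}_n=\exp(\mathbf{K}_n)$; $\mathbf{C}_n=\left[\mathbf{1}_s\ \ \mathbf{c}\ \ \tfrac{\mathbf{c}^2}{2}\ \cdots\ \tfrac{\mathbf{c}^{n-1}}{(n-1)!}\right]\in\mathbb{R}^{s\times n}$, with component-wise powers and $\mathbf{1}_s$ the vector of ones.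 Known characterization (Zhang, Sandu, Blaise), which may be used: the IMEX GLM has order $p$ and stage order $q\in\{p,p-1\}$ iff $$\mathbf{C}_{q+1}-\mathbf{A}\mathbf{C}_{q+1}\mathbf{K}_{q+1}-\mathbf{U}\mathbf{W}_{:,0:q}=\mathbf{0},\qquad \mathbf{C}_{q+1}-\widehat{\mathbf{A}}\mathbf{C}_{q+1}\mathbf{K}_{q+1}-\mathbf{U}\widehat{\mathbf{W}}_{:,0:q}=\mathbf{0},$$ $$\mathbf{W}\mathbf{E}_{p+1}-\mathbf{B}\mathbf{C}_{p+1}\mathbf{K}_{p+1}-\mathbf{V}\mathbf{W}=\mathbf{0},\qquad \widehat{\mathbf{W}}\mathbf{E}_{p+1}-\widehat{\mathbf{B}}\mathbf{C}_{p+1}\mathbf{K}_{p+1}-\mathbf{V}\widehat{\mathbf{W}}=\mathbf{0},$$ where $\mathbf{W}_{:,0:q}$ denotes the first $q+1$ columns. The explicit base method has order $p$ and stage order $q$ iff the two conditions without hats hold, and the implicit base method iff the two conditions with hats hold. *)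

theory Defs
  imports
    "HOL-Analysis.Analysis"
    "HOL-Library.Landau_Symbols"
    "Jordan_Normal_Form.Gauss_Jordan_Elimination"
begin

text \<open>Throughout, the phase space \<open>\<real>\<^sup>d\<close> is an arbitrary type \<open>'a\<close> of class
  \<open>euclidean_space\<close>. Stage indices run from \<open>0\<close> instead of \<open>1\<close>; columns of the weight
  matrices run over \<open>k = 0, \<dots>, p\<close>.\<close>

section \<open>The matrices \<open>K\<^sub>n\<close>, \<open>E\<^sub>n\<close>, \<open>C\<^sub>n\<close>\<close>

text \<open>The library's \<open>exp\<close> needs a normed algebra type, which \<open>real mat\<close> is not: the power series
  is summed entry by entry.\<close>

definition mat_exp :: "real mat \<Rightarrow> real mat" where
  "mat_exp A = mat (dim_row A) (dim_col A) (\<lambda>ij. \<Sum>m. (A ^\<^sub>m m) $$ ij / fact m)"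

definition K_mat :: "nat \<Rightarrow> real mat" where
  "K_mat n = mat n n (\<lambda>(i, j). if j = i + 1 then 1 else 0)"

definition E_mat :: "nat \<Rightarrow> real mat" where
  "E_mat n = mat_exp (K_mat n)"

definition C_mat :: "real vec \<Rightarrow> nat \<Rightarrow> real mat" where
  "C_mat c n = mat (dim_vec c) n (\<lambda>(i, k). vec_index c i ^ k / fact k)"

section \<open>Coefficients\<close>

record glm =
  glm_c :: "real vec"
  glm_A :: "real mat"
  glm_B :: "real mat"
  glm_U :: "real mat"
  glm_V :: "real mat"
  glm_W :: "real mat"

text \<open>A trailing \<open>h\<close> marks the coefficients that carry a hat.\<close>

record imex_glm =
  imex_c :: "real vec"
  imex_A :: "real mat"
  imex_Ah :: "real mat"
  imex_B :: "real mat"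
  imex_Bh :: "real mat"
  imex_U :: "real mat"
  imex_V :: "real mat"
  imex_W :: "real mat"
  imex_Wh :: "real mat"

definition is_imex_glm :: "nat \<Rightarrow> nat \<Rightarrow> nat \<Rightarrow> imex_glm \<Rightarrow> bool" where
  "is_imex_glm s r p M \<longleftrightarrow>
     imex_c M \<in> carrier_vec s \<and>
     imex_A M \<in> carrier_mat s s \<and> imex_Ah M \<in> carrier_mat s s \<and>
     imex_B M \<in> carrier_mat r s \<and> imex_Bh M \<in> carrier_mat r s \<and>
     imex_U M \<in> carrier_mat s r \<and> imex_V M \<in> carrier_mat r r \<and>
     imex_W M \<in> carrier_mat r (p + 1) \<and> imex_Wh M \<in> carrier_mat r (p + 1) \<and>
     (\<forall>i<s. \<forall>j<s. i \<le> j \<longrightarrow> imex_A M $$ (i, j) = 0) \<and>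
     (\<forall>i<s. \<forall>j<s. i < j \<longrightarrow> imex_Ah M $$ (i, j) = 0) \<and>
     (\<forall>i<r. imex_W M $$ (i, 0) = imex_Wh M $$ (i, 0))"

definition nonconfluent :: "imex_glm \<Rightarrow> bool" where
  "nonconfluent M \<longleftrightarrow> inj_on (vec_index (imex_c M)) {..<dim_vec (imex_c M)}"

definition parallel_imex :: "real \<Rightarrow> imex_glm \<Rightarrow> bool" where
  "parallel_imex l M \<longleftrightarrow> l > 0 \<and>
     (let s = dim_vec (imex_c M) in imex_A M = 0\<^sub>m s s \<and> imex_Ah M = l \<cdot>\<^sub>m 1\<^sub>m s)"

definition explicit_base :: "imex_glm \<Rightarrow> glm" where
  "explicit_base M = \<lparr>glm_c = imex_c M, glm_A = imex_A M, glm_B = imex_B M,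
     glm_U = imex_U M, glm_V = imex_V M, glm_W = imex_W M\<rparr>"

definition implicit_base :: "imex_glm \<Rightarrow> glm" where
  "implicit_base M = \<lparr>glm_c = imex_c M, glm_A = imex_Ah M, glm_B = imex_Bh M,
     glm_U = imex_U M, glm_V = imex_V M, glm_W = imex_Wh M\<rparr>"

section \<open>Problems\<close>

text \<open>\<open>C_k n f\<close>: \<open>f\<close> is \<open>n\<close> times continuously differentiable on the whole space. In finite
  dimensions it suffices that all directional derivatives are of class \<open>C\<^sup>n\<^sup>-\<^sup>1\<close>.\<close>

primrec C_k :: "nat \<Rightarrow> ('a::euclidean_space \<Rightarrow> 'a) \<Rightarrow> bool" where
  "C_k 0 f \<longleftrightarrow> continuous_on UNIV f"
| "C_k (Suc n) f \<longleftrightarrow> f differentiable_on UNIV \<and>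
     (\<forall>v. C_k n (\<lambda>x. frechet_derivative f (at x) v))"

definition solves_near :: "('a::euclidean_space \<Rightarrow> 'a) \<Rightarrow> (real \<Rightarrow> 'a) \<Rightarrow> real \<Rightarrow> bool" where
  "solves_near F y t0 \<longleftrightarrow> (\<forall>\<^sub>F t in nhds t0. (y has_vector_derivative F (y t)) (at t))"

definition tderiv :: "nat \<Rightarrow> (real \<Rightarrow> 'a::euclidean_space) \<Rightarrow> real \<Rightarrow> 'a" where
  "tderiv k = (\<lambda>\<phi> t. vector_derivative \<phi> (at t)) ^^ k"

text \<open>\<open>h \<mapsto> u h\<close> is \<open>O(h\<^sup>m)\<close> as the timestep \<open>h > 0\<close> tends to \<open>0\<close>.\<close>

definition O_h :: "nat \<Rightarrow> (real \<Rightarrow> 'a::euclidean_space) \<Rightarrow> bool" where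
  "O_h m u \<longleftrightarrow> (\<lambda>h. norm (u h)) \<in> O[at_right 0](\<lambda>h. h ^ m)"

section \<open>Order of an IMEX GLM\<close>

text \<open>One step is studied as \<open>h \<rightarrow> 0\<close>, so the external stages \<open>x h j\<close> entering the step from time
  \<open>t0\<close>, and the internal stages \<open>Y h i\<close>, are functions of the timestep \<open>h\<close>.\<close>

definition imex_expansion ::
  "nat \<Rightarrow> imex_glm \<Rightarrow> ('a::euclidean_space \<Rightarrow> 'a) \<Rightarrow> ('a \<Rightarrow> 'a) \<Rightarrow> (real \<Rightarrow> 'a) \<Rightarrow> real \<Rightarrow> real \<Rightarrow> nat \<Rightarrow> 'a" where
  "imex_expansion p M f g y h t i =
     (imex_W M $$ (i, 0)) *\<^sub>R y t
     + (\<Sum>k=1..p. (imex_W M $$ (i, k) * h ^ k) *\<^sub>R tderiv (k - 1) (\<lambda>\<tau>. f (y \<tau>)) t)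
     + (\<Sum>k=1..p. (imex_Wh M $$ (i, k) * h ^ k) *\<^sub>R tderiv (k - 1) (\<lambda>\<tau>. g (y \<tau>)) t)"

definition imex_stages ::
  "imex_glm \<Rightarrow> ('a::euclidean_space \<Rightarrow> 'a) \<Rightarrow> ('a \<Rightarrow> 'a) \<Rightarrow> real \<Rightarrow> (nat \<Rightarrow> 'a) \<Rightarrow> (nat \<Rightarrow> 'a) \<Rightarrow> bool" where
  "imex_stages M f g h x Y \<longleftrightarrow> (\<forall>i<dim_vec (imex_c M).
     Y i = h *\<^sub>R (\<Sum>j<i. imex_A M $$ (i, j) *\<^sub>R f (Y j))
         + h *\<^sub>R (\<Sum>j\<le>i. imex_Ah M $$ (i, j) *\<^sub>R g (Y j))
         + (\<Sum>j<dim_col (imex_U M). imex_U M $$ (i, j) *\<^sub>R x j))"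

definition imex_output ::
  "imex_glm \<Rightarrow> ('a::euclidean_space \<Rightarrow> 'a) \<Rightarrow> ('a \<Rightarrow> 'a) \<Rightarrow> real \<Rightarrow> (nat \<Rightarrow> 'a) \<Rightarrow> (nat \<Rightarrow> 'a) \<Rightarrow> nat \<Rightarrow> 'a" where
  "imex_output M f g h x Y i =
     h *\<^sub>R (\<Sum>j<dim_vec (imex_c M). imex_B M $$ (i, j) *\<^sub>R f (Y j) + imex_Bh M $$ (i, j) *\<^sub>R g (Y j))
     + (\<Sum>j<dim_col (imex_V M). imex_V M $$ (i, j) *\<^sub>R x j)"

text \<open>The implicit stage equations may also have spurious solutions which blow up as \<open>h \<rightarrow> 0\<close>
  (such as \<open>Y \<approx> 1 / (\<lambda> h)\<close> for \<open>g(y) = y\<^sup>2\<close>). As usual, the internal stages are those on the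
  solution branch given by the implicit function theorem, which is selected here by boundedness
  as \<open>h \<rightarrow> 0\<close>. Convergence to \<open>y t0\<close> is not presupposed: this is part of what the order
  conditions say, and assuming it would make them vacuous for inconsistent methods.\<close>

definition imex_step ::
  "nat \<Rightarrow> imex_glm \<Rightarrow> ('a::euclidean_space \<Rightarrow> 'a) \<Rightarrow> ('a \<Rightarrow> 'a) \<Rightarrow> (real \<Rightarrow> 'a) \<Rightarrow> real
   \<Rightarrow> (real \<Rightarrow> nat \<Rightarrow> 'a) \<Rightarrow> (real \<Rightarrow> nat \<Rightarrow> 'a) \<Rightarrow> bool" where
  "imex_step p M f g y t0 x Y \<longleftrightarrow>
     solves_near (\<lambda>v. f v + g v) y t0 \<and>
     (\<forall>j<dim_col (imex_U M). O_h (p + 1) (\<lambda>h. x h j - imex_expansion p M f g y h t0 j)) \<and>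
     (\<forall>\<^sub>F h in at_right 0. imex_stages M f g h (x h) (Y h)) \<and>
     (\<forall>i<dim_vec (imex_c M). O_h 0 (\<lambda>h. Y h i))"

text \<open>``Sufficiently smooth'' is read as: of class \<open>C\<^sup>N\<close> for some \<open>N\<close> that does not depend on the
  problem. The first argument only selects the phase space.\<close>

definition imex_stage_order :: "'a::euclidean_space itself \<Rightarrow> nat \<Rightarrow> nat \<Rightarrow> imex_glm \<Rightarrow> bool" where
  "imex_stage_order d p q M \<longleftrightarrow> (\<exists>N. \<forall>(f :: 'a \<Rightarrow> 'a) g y t0 x Y.
     C_k N f \<and> C_k N g \<and> imex_step p M f g y t0 x Y \<longrightarrow>
     (\<forall>i<dim_vec (imex_c M). O_h (q + 1) (\<lambda>h. Y h i - y (t0 + vec_index (imex_c M) i * h))))"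

definition imex_order :: "'a::euclidean_space itself \<Rightarrow> nat \<Rightarrow> imex_glm \<Rightarrow> bool" where
  "imex_order d p M \<longleftrightarrow> (\<exists>N. \<forall>(f :: 'a \<Rightarrow> 'a) g y t0 x Y.
     C_k N f \<and> C_k N g \<and> imex_step p M f g y t0 x Y \<longrightarrow>
     (\<forall>i<dim_row (imex_V M).
        O_h (p + 1) (\<lambda>h. imex_output M f g h (x h) (Y h) i - imex_expansion p M f g y h (t0 + h) i)))"

section \<open>Order of a GLM\<close>

definition glm_expansion ::
  "nat \<Rightarrow> glm \<Rightarrow> ('a::euclidean_space \<Rightarrow> 'a) \<Rightarrow> (real \<Rightarrow> 'a) \<Rightarrow> real \<Rightarrow> real \<Rightarrow> nat \<Rightarrow> 'a" where
  "glm_expansion p M f y h t i =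
     (glm_W M $$ (i, 0)) *\<^sub>R y t
     + (\<Sum>k=1..p. (glm_W M $$ (i, k) * h ^ k) *\<^sub>R tderiv (k - 1) (\<lambda>\<tau>. f (y \<tau>)) t)"

definition glm_stages ::
  "glm \<Rightarrow> ('a::euclidean_space \<Rightarrow> 'a) \<Rightarrow> real \<Rightarrow> (nat \<Rightarrow> 'a) \<Rightarrow> (nat \<Rightarrow> 'a) \<Rightarrow> bool" where
  "glm_stages M f h x Y \<longleftrightarrow> (\<forall>i<dim_vec (glm_c M).
     Y i = h *\<^sub>R (\<Sum>j<dim_vec (glm_c M). glm_A M $$ (i, j) *\<^sub>R f (Y j))
         + (\<Sum>j<dim_col (glm_U M). glm_U M $$ (i, j) *\<^sub>R x j))"

definition glm_output ::
  "glm \<Rightarrow> ('a::euclidean_space \<Rightarrow> 'a) \<Rightarrow> real \<Rightarrow> (nat \<Rightarrow> 'a) \<Rightarrow> (nat \<Rightarrow> 'a) \<Rightarrow> nat \<Rightarrow> 'a" where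
  "glm_output M f h x Y i =
     h *\<^sub>R (\<Sum>j<dim_vec (glm_c M). glm_B M $$ (i, j) *\<^sub>R f (Y j))
     + (\<Sum>j<dim_col (glm_V M). glm_V M $$ (i, j) *\<^sub>R x j)"

definition glm_step ::
  "nat \<Rightarrow> glm \<Rightarrow> ('a::euclidean_space \<Rightarrow> 'a) \<Rightarrow> (real \<Rightarrow> 'a) \<Rightarrow> real
   \<Rightarrow> (real \<Rightarrow> nat \<Rightarrow> 'a) \<Rightarrow> (real \<Rightarrow> nat \<Rightarrow> 'a) \<Rightarrow> bool" where
  "glm_step p M f y t0 x Y \<longleftrightarrow>
     solves_near f y t0 \<and>
     (\<forall>j<dim_col (glm_U M). O_h (p + 1) (\<lambda>h. x h j - glm_expansion p M f y h t0 j)) \<and>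
     (\<forall>\<^sub>F h in at_right 0. glm_stages M f h (x h) (Y h)) \<and>
     (\<forall>i<dim_vec (glm_c M). O_h 0 (\<lambda>h. Y h i))"

definition glm_stage_order :: "'a::euclidean_space itself \<Rightarrow> nat \<Rightarrow> nat \<Rightarrow> glm \<Rightarrow> bool" where
  "glm_stage_order d p q M \<longleftrightarrow> (\<exists>N. \<forall>(f :: 'a \<Rightarrow> 'a) y t0 x Y.
     C_k N f \<and> glm_step p M f y t0 x Y \<longrightarrow>
     (\<forall>i<dim_vec (glm_c M). O_h (q + 1) (\<lambda>h. Y h i - y (t0 + vec_index (glm_c M) i * h))))"

definition glm_order :: "'a::euclidean_space itself \<Rightarrow> nat \<Rightarrow> glm \<Rightarrow> bool" where
  "glm_order d p M \<longleftrightarrow> (\<exists>N. \<forall>(f :: 'a \<Rightarrow> 'a) y t0 x Y.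
     C_k N f \<and> glm_step p M f y t0 x Y \<longrightarrow>
     (\<forall>i<dim_row (glm_V M).
        O_h (p + 1) (\<lambda>h. glm_output M f h (x h) (Y h) i - glm_expansion p M f y h (t0 + h) i)))"

end

theory Submission
  imports Defs "Jordan_Normal_Form.Determinant"
begin

text \<open>Everything is reduced to the order conditions \<open>W = C\<close>, \<open>Wh = C - \<lambda> C K\<close>,
  \<open>W E - B C K - V W = 0\<close> and \<open>Wh E - Bh C K - V Wh = 0\<close>. They are necessary because the
  linear problem \<open>y' = y\<close>, assigned to \<open>f\<close> or to \<open>g\<close> alone, already determines all coefficients
  of the powers of \<open>h\<close>. They are sufficient by Taylor expansion: the exact values
  \<open>y(t0 + c\<^sub>i h)\<close> satisfy the stage equations up to \<open>O(h\<^sup>s\<^sup>+\<^sup>1)\<close>, and on bounded sets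
  \<open>u \<mapsto> u - h \<lambda> g(u)\<close> has a Lipschitz inverse for small \<open>h\<close>. Given the first two conditions, the
  last two differ by \<open>((B - Bh) C - \<lambda> (C E - V C)) K\<close>, which vanishes iff the formula for \<open>Bh\<close>
  holds, since the first \<open>s\<close> columns of \<open>C\<close> form the invertible Vandermonde-type matrix
  \<open>C\<^sub>s\<close>.\<close>

section \<open>Asymptotics in the timestep\<close>

text \<open>The order of a base method concerns \<open>f\<close> alone or \<open>g\<close> alone,
  whereas in the coupled problem \<open>y\<close> depends on both. The coupled problem is therefore
  no special case of the base problems, and the way back to the IMEX method leads through the
  coefficients. What makes this possible is that the coupled expansion splits: along a solution of
  y' = f(y) + g(y), the time derivatives of f(y(t)) and those of g(y(t)) serve as two separate
  coordinate sequences, each acted on by one of the two weight matrices, while their sum gives the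
  derivatives of \<open>y\<close>. The only shared term is the one with y(t0) itself; here the
  agreement of the first columns of \<open>W\<close> and \<open>Wh\<close> enters. The test problem
  y' = y is strong enough for necessity because all derivatives of exp(t) b at 0 equal b: every
  expansion is a scalar polynomial in \<open>h\<close> times one fixed vector, and its coefficients
  can be compared.\<close>

lemma O_h_iff: "O_h m u \<longleftrightarrow> (\<exists>C. \<forall>\<^sub>F h in at_right 0. norm (u h) \<le> C * h ^ m)"
proof
  assume "O_h m u"
  then obtain C where "\<forall>\<^sub>F h in at_right 0. norm (norm (u h)) \<le> C * norm (h ^ m)"
    unfolding O_h_def bigo_def by auto
  then have "\<forall>\<^sub>F h in at_right 0. norm (u h) \<le> C * h ^ m"
    using eventually_at_right_less by eventually_elim auto
  then show "\<exists>C. \<forall>\<^sub>F h in at_right 0. norm (u h) \<le> C * h ^ m" ..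
next
  assume "\<exists>C. \<forall>\<^sub>F h in at_right 0. norm (u h) \<le> C * h ^ m"
  then obtain C where "\<forall>\<^sub>F h in at_right 0. norm (u h) \<le> C * h ^ m" ..
  then have "\<forall>\<^sub>F h in at_right 0. norm (norm (u h)) \<le> C * norm (h ^ m)"
    using eventually_at_right_less by eventually_elim auto
  then show "O_h m u"
    unfolding O_h_def by (rule bigoI)
qed

lemma O_h_zero [simp]: "O_h m (\<lambda>h. 0)"
  by (simp add: O_h_def)

lemma O_h_cong: "(\<forall>\<^sub>F h in at_right 0. u h = v h) \<Longrightarrow> O_h m u \<longleftrightarrow> O_h m v"
  unfolding O_h_def by (intro landau_o.big.in_cong) (auto elim: eventually_mono)

lemma O_h_add:
  assumes "O_h m u" "O_h m v"
  shows "O_h m (\<lambda>h. u h + v h)"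
proof -
  obtain C D where "\<forall>\<^sub>F h in at_right 0. norm (u h) \<le> C * h ^ m"
      "\<forall>\<^sub>F h in at_right 0. norm (v h) \<le> D * h ^ m"
    using assms O_h_iff by blast
  then have "\<forall>\<^sub>F h in at_right 0. norm (u h + v h) \<le> (C + D) * h ^ m"
    by eventually_elim (auto simp: ring_distribs intro: norm_triangle_le)
  then show ?thesis
    using O_h_iff by blast
qed

lemma O_h_scaleR:
  assumes "O_h m u"
  shows "O_h m (\<lambda>h. a *\<^sub>R u h)"
proof -
  obtain C where "\<forall>\<^sub>F h in at_right 0. norm (u h) \<le> C * h ^ m"
    using assms O_h_iff by blast
  then have "\<forall>\<^sub>F h in at_right 0. norm (a *\<^sub>R u h) \<le> (\<bar>a\<bar> * C) * h ^ m"
    by eventually_elim (auto simp: mult.assoc intro: mult_left_mono)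
  then show ?thesis
    using O_h_iff by blast
qed

lemma O_h_diff: "O_h m u \<Longrightarrow> O_h m v \<Longrightarrow> O_h m (\<lambda>h. u h - v h)"
  using O_h_add[of m u "\<lambda>h. (-1) *\<^sub>R v h"] O_h_scaleR[of m v "-1"] by simp

lemma O_h_sum: "(\<And>i. i \<in> I \<Longrightarrow> O_h m (u i)) \<Longrightarrow> O_h m (\<lambda>h. \<Sum>i\<in>I. u i h)"
  by (induction I rule: infinite_finite_induct) (auto intro: O_h_add)

lemma O_h_power_scaleR:
  assumes "O_h m u"
  shows "O_h (k + m) (\<lambda>h. h ^ k *\<^sub>R u h)"
proof -
  obtain C where "\<forall>\<^sub>F h in at_right 0. norm (u h) \<le> C * h ^ m"
    using assms O_h_iff by blast
  then have "\<forall>\<^sub>F h in at_right 0. norm (h ^ k *\<^sub>R u h) \<le> C * h ^ (k + m)"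
    using eventually_at_right_less
  proof eventually_elim
    case (elim h)
    then have "h ^ k * norm (u h) \<le> h ^ k * (C * h ^ m)"
      by (intro mult_left_mono) auto
    with elim show ?case
      by (simp add: power_add mult_ac)
  qed
  then show ?thesis
    using O_h_iff by blast
qed

lemma O_h_mono:
  assumes "O_h n u" "m \<le> n"
  shows "O_h m u"
proof -
  obtain C where "\<forall>\<^sub>F h in at_right 0. norm (u h) \<le> C * h ^ n"
    using assms O_h_iff by blast
  moreover have "\<forall>\<^sub>F h in at_right (0::real). h < 1"
    using eventually_at_right_real[of 0 "1::real"] by (auto elim: eventually_mono)
  ultimately have "\<forall>\<^sub>F h in at_right 0. norm (u h) \<le> \<bar>C\<bar> * h ^ m"
    using eventually_at_right_less
  proof eventually_elim
    case (elim h)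
    have "C * h ^ n \<le> \<bar>C\<bar> * h ^ m"
      using elim assms(2) by (intro mult_mono power_decreasing) auto
    with elim(1) show ?case by linarith
  qed
  then show ?thesis
    using O_h_iff by blast
qed

lemma O_h_tendsto_0:
  assumes "O_h (Suc m) u"
  shows "(u \<longlongrightarrow> 0) (at_right 0)"
proof -
  obtain C where C: "\<forall>\<^sub>F h in at_right 0. norm (u h) \<le> C * h ^ Suc m"
    using assms O_h_iff by blast
  have "((\<lambda>h::real. C * h ^ Suc m) \<longlongrightarrow> C * 0 ^ Suc m) (at_right 0)"
    by (intro tendsto_intros)
  then have "((\<lambda>h::real. C * h ^ Suc m) \<longlongrightarrow> 0) (at_right 0)"
    by simp
  with C show ?thesis
    by (rule Lim_null_comparison)
qed

lemma O_h_tendsto: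
  assumes "(u \<longlongrightarrow> c) (at_right 0)"
  shows "O_h 0 u"
proof -
  have "((\<lambda>h. norm (u h)) \<longlongrightarrow> norm c) (at_right 0)"
    using assms by (rule tendsto_norm)
  then have "\<forall>\<^sub>F h in at_right 0. norm (u h) < norm c + 1"
    by (rule order_tendstoD) simp
  then have "\<forall>\<^sub>F h in at_right 0. norm (u h) \<le> (norm c + 1) * h ^ 0"
    by eventually_elim simp
  then show ?thesis
    using O_h_iff by blast
qed

lemma O_h_trans: "O_h m (\<lambda>h. u h - v h) \<Longrightarrow> O_h m (\<lambda>h. v h - w h) \<Longrightarrow> O_h m (\<lambda>h. u h - w h)"
  using O_h_add[of m "\<lambda>h. u h - v h" "\<lambda>h. v h - w h"] by simp

text \<open>Comparison of coefficients: letting \<open>h\<close> tend to 0 forces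
  \<open>a 0 = 0\<close>, after which a factor \<open>h\<close> splits off and the induction applies
  to the shifted sequence. This turns an order statement into \<open>s + 1\<close> scalar
  identities.\<close>

lemma polynomial_O_h_imp_zero:
  fixes a :: "nat \<Rightarrow> real" and b :: "'a::euclidean_space"
  assumes "O_h (Suc n) (\<lambda>h. (\<Sum>k\<le>n. a k * h ^ k) *\<^sub>R b)" "b \<noteq> 0" "k \<le> n"
  shows "a k = 0"
  using assms(1,3)
proof (induction n arbitrary: a k)
  case 0
  have "((\<lambda>h::real. (\<Sum>k\<le>0. a k * h ^ k) *\<^sub>R b) \<longlongrightarrow> 0) (at_right 0)"
    using 0(1) by (rule O_h_tendsto_0)
  then have "a 0 *\<^sub>R b = 0"
    using tendsto_const_iff[of "at_right (0::real)" "a 0 *\<^sub>R b" 0] by simp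
  with 0 assms(2) show ?case by simp
next
  case (Suc n)
  let ?p = "\<lambda>h::real. (\<Sum>k\<le>Suc n. a k * h ^ k) *\<^sub>R b"
  have "(?p \<longlongrightarrow> 0) (at_right 0)"
    using Suc.prems(1) by (rule O_h_tendsto_0)
  moreover have "(?p \<longlongrightarrow> (\<Sum>k\<le>Suc n. a k * 0 ^ k) *\<^sub>R b) (at_right 0)"
    by (intro tendsto_intros)
  ultimately have "(\<Sum>k\<le>Suc n. a k * 0 ^ k) *\<^sub>R b = 0"
    using tendsto_unique trivial_limit_at_right_real by blast
  then have a0: "a 0 = 0"
    using assms(2) by (simp add: sum.atMost_Suc_shift del: sum.atMost_Suc)
  have shift: "?p h = h *\<^sub>R ((\<Sum>k\<le>n. a (Suc k) * h ^ k) *\<^sub>R b)" for h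
    by (simp add: sum.atMost_Suc_shift a0 sum_distrib_left mult_ac del: sum.atMost_Suc)
  obtain C where C: "\<forall>\<^sub>F h in at_right 0. norm (?p h) \<le> C * h ^ Suc (Suc n)"
    using Suc.prems(1) unfolding O_h_iff by blast
  have "\<forall>\<^sub>F h in at_right 0. norm ((\<Sum>k\<le>n. a (Suc k) * h ^ k) *\<^sub>R b) \<le> C * h ^ Suc n"
    using C eventually_at_right_less
  proof eventually_elim
    case (elim h)
    have "norm (?p h) = h * norm ((\<Sum>k\<le>n. a (Suc k) * h ^ k) *\<^sub>R b)"
      unfolding shift norm_scaleR[of h] using elim(2) by simp
    moreover have "C * h ^ Suc (Suc n) = h * (C * h ^ Suc n)"
      by simp
    ultimately have "h * norm ((\<Sum>k\<le>n. a (Suc k) * h ^ k) *\<^sub>R b) \<le> h * (C * h ^ Suc n)"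
      using elim(1) by (simp only:)
    with elim(2) show ?case
      by (simp only: mult_le_cancel_left_pos)
  qed
  then have "O_h (Suc n) (\<lambda>h. (\<Sum>k\<le>n. a (Suc k) * h ^ k) *\<^sub>R b)"
    using O_h_iff by blast
  then have "a (Suc j) = 0" if "j \<le> n" for j
    using Suc.IH[of "\<lambda>k. a (Suc k)" j] that by simp
  with a0 Suc.prems(2) show ?case
    by (cases k) auto
qed

section \<open>Smoothness of solutions and Taylor expansion\<close>

lemma tderiv_0 [simp]: "tderiv 0 u = u"
  by (simp add: tderiv_def)

lemma tderiv_Suc: "tderiv (Suc k) u = (\<lambda>t. vector_derivative (tderiv k u) (at t))"
  by (simp add: tderiv_def)

lemma tderiv_Suc_shift: "tderiv (Suc k) u = tderiv k (\<lambda>t. vector_derivative u (at t))"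
  by (simp add: tderiv_def funpow_Suc_right del: funpow.simps)

lemma tderiv_cong:
  assumes "\<forall>\<^sub>F t in nhds t0. u t = v t"
  shows "\<forall>\<^sub>F t in nhds t0. tderiv k u t = tderiv k v t"
proof (induction k)
  case (Suc k)
  then have "\<forall>\<^sub>F t in nhds t0. \<forall>\<^sub>F x in nhds t. tderiv k u x = tderiv k v x"
    by (simp add: eventually_eventually)
  then show ?case
    unfolding tderiv_Suc
    by eventually_elim (rule vector_derivative_cong_eq, auto)
qed (use assms in simp)

text \<open>The derivative is an existential witness rather than \<open>vector_derivative\<close>,
  so that closure under sums and products follows by exhibiting a formula. Only a neighbourhood of
  \<open>t0\<close> is involved because \<open>solves_near\<close> controls a solution only
  there.\<close>

primrec smooth_near :: "nat \<Rightarrow> real \<Rightarrow> (real \<Rightarrow> 'a::real_normed_vector) \<Rightarrow> bool" where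
  "smooth_near 0 t0 u \<longleftrightarrow> (\<forall>\<^sub>F t in nhds t0. isCont u t)"
| "smooth_near (Suc n) t0 u \<longleftrightarrow>
     (\<exists>u'. (\<forall>\<^sub>F t in nhds t0. (u has_vector_derivative u' t) (at t)) \<and> smooth_near n t0 u')"

lemma smooth_near_SucD: "smooth_near (Suc n) t0 u \<Longrightarrow> smooth_near n t0 u"
proof (induction n arbitrary: u)
  case 0
  then show ?case
    by (auto elim!: eventually_mono intro: has_vector_derivative_continuous)
next
  case (Suc n)
  from Suc.prems obtain u' where "\<forall>\<^sub>F t in nhds t0. (u has_vector_derivative u' t) (at t)"
    and "smooth_near (Suc n) t0 u'"
    unfolding smooth_near.simps(2)[of "Suc n"] by blast
  with Suc.IH[of u'] show ?case
    unfolding smooth_near.simps(2)[of n] by blast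
qed

lemma smooth_near_add:
  "smooth_near n t0 u \<Longrightarrow> smooth_near n t0 v \<Longrightarrow> smooth_near n t0 (\<lambda>t. u t + v t)"
proof (induction n arbitrary: u v)
  case 0
  then have "\<forall>\<^sub>F t in nhds t0. isCont u t" "\<forall>\<^sub>F t in nhds t0. isCont v t" by auto
  then show ?case
    unfolding smooth_near.simps by eventually_elim (auto intro: continuous_intros)
next
  case (Suc n)
  from Suc.prems obtain u' v' where
    d: "\<forall>\<^sub>F t in nhds t0. (u has_vector_derivative u' t) (at t)"
       "\<forall>\<^sub>F t in nhds t0. (v has_vector_derivative v' t) (at t)"
    and s: "smooth_near n t0 u'" "smooth_near n t0 v'"
    by auto
  from d have "\<forall>\<^sub>F t in nhds t0. ((\<lambda>t. u t + v t) has_vector_derivative u' t + v' t) (at t)"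
    by eventually_elim (rule has_vector_derivative_add)
  with Suc.IH[OF s] show ?case by auto
qed

lemma smooth_near_const: "smooth_near n t0 (\<lambda>t. c)"
proof (induction n arbitrary: c)
  case (Suc n)
  show ?case
    unfolding smooth_near.simps by (intro exI[of _ "\<lambda>t. 0"]) (use Suc in auto)
qed auto

lemma smooth_near_sum:
  "(\<And>i. i \<in> I \<Longrightarrow> smooth_near n t0 (u i)) \<Longrightarrow> smooth_near n t0 (\<lambda>t. \<Sum>i\<in>I. u i t)"
  by (induction I rule: infinite_finite_induct)
     (auto intro: smooth_near_add smooth_near_const)

text \<open>Covers both products that occur in the chain rule for f(y(t)): scalar multiplication and
  the inner product with a basis vector.\<close>

lemma smooth_near_bilinear:
  assumes "bounded_bilinear B"
  shows "smooth_near n t0 u \<Longrightarrow> smooth_near n t0 v \<Longrightarrow> smooth_near n t0 (\<lambda>t. B (u t) (v t))"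
proof (induction n arbitrary: u v)
  case 0
  then have "\<forall>\<^sub>F t in nhds t0. isCont u t" "\<forall>\<^sub>F t in nhds t0. isCont v t" by auto
  then show ?case
    unfolding smooth_near.simps by eventually_elim (rule bounded_bilinear.isCont[OF assms])
next
  case (Suc n)
  from Suc.prems obtain u' v' where
    d: "\<forall>\<^sub>F t in nhds t0. (u has_vector_derivative u' t) (at t)"
       "\<forall>\<^sub>F t in nhds t0. (v has_vector_derivative v' t) (at t)"
    and s: "smooth_near n t0 u'" "smooth_near n t0 v'"
    by auto
  from d have "\<forall>\<^sub>F t in nhds t0.
      ((\<lambda>t. B (u t) (v t)) has_vector_derivative B (u t) (v' t) + B (u' t) (v t)) (at t)"
    by eventually_elim (rule bounded_bilinear.has_vector_derivative[OF assms])
  moreover have "smooth_near n t0 (\<lambda>t. B (u t) (v' t) + B (u' t) (v t))"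
    using Suc.IH s Suc.prems[THEN smooth_near_SucD] by (intro smooth_near_add) auto
  ultimately show ?case by auto
qed

section \<open>Maps of class \<open>C_k\<close> and regularity along solutions\<close>

lemma C_k_SucD: "C_k (Suc n) f \<Longrightarrow> C_k n f"
proof (induction n arbitrary: f)
  case 0
  then show ?case by (auto intro: differentiable_imp_continuous_on)
next
  case (Suc n)
  then show ?case
    unfolding C_k.simps(2)[of "Suc n"] C_k.simps(2)[of n] by blast
qed

lemma C_k_frechet_derivative:
  assumes "C_k (Suc n) f"
  shows "(f has_derivative frechet_derivative f (at x)) (at x)"
  using assms by (simp add: differentiable_on_def frechet_derivative_works)

lemma C_k_const: "C_k n (\<lambda>x. c)"
  by (induction n arbitrary: c) (auto simp: frechet_derivative_const)

lemma C_k_ident: "C_k n (\<lambda>x. x)"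
  by (cases n) (auto simp: frechet_derivative_ident C_k_const differentiable_on_def)

lemma C_k_add: "C_k n f \<Longrightarrow> C_k n g \<Longrightarrow> C_k n (\<lambda>x. f x + g x)"
proof (induction n arbitrary: f g)
  case 0
  then show ?case by (auto intro: continuous_intros)
next
  case (Suc n)
  have d: "((\<lambda>x. f x + g x) has_derivative
      (\<lambda>v. frechet_derivative f (at x) v + frechet_derivative g (at x) v)) (at x)" for x
    using Suc.prems[THEN C_k_frechet_derivative] by (intro has_derivative_add)
  then have "frechet_derivative (\<lambda>x. f x + g x) (at x) v
      = frechet_derivative f (at x) v + frechet_derivative g (at x) v" for x v
    using fun_cong[OF frechet_derivative_at[OF d[of x]]] by simp
  with Suc d show ?case
    by (auto simp: differentiable_on_def differentiable_def)
qed

text \<open>A bootstrap: the derivative of f(y(t)) is built from F(y(t)) and from directional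
  derivatives of \<open>f\<close> along \<open>y\<close>, all of one class lower. The induction
  keeps \<open>f\<close> arbitrary since it is applied to \<open>F\<close> and to these directional
  derivatives.\<close>

lemma smooth_near_solution:
  assumes sol: "solves_near F y t0"
  shows "C_k n F \<Longrightarrow> C_k n f \<Longrightarrow> smooth_near n t0 (\<lambda>t. f (y t))"
proof (induction n arbitrary: f)
  case 0
  have "\<forall>\<^sub>F t in nhds t0. isCont y t"
    using sol unfolding solves_near_def
    by (auto elim!: eventually_mono intro: has_vector_derivative_continuous)
  then show ?case
    unfolding smooth_near.simps
  proof eventually_elim
    case (elim t)
    with 0 show ?case
      by (auto simp: continuous_on_eq_continuous_at intro: isCont_o2)
  qed
next
  case (Suc n)
  \<comment> \<open>\<open>C_k\<close> speaks of derivatives in fixed directions only, so the moving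
    direction \<open>F (y t)\<close> is expanded in the basis.\<close>
  let ?d = "\<lambda>t. \<Sum>b\<in>Basis. (F (y t) \<bullet> b) *\<^sub>R frechet_derivative f (at (y t)) b"
  have "\<forall>\<^sub>F t in nhds t0. ((\<lambda>t. f (y t)) has_vector_derivative ?d t) (at t)"
    using sol unfolding solves_near_def
  proof eventually_elim
    case (elim t)
    have f': "(f has_derivative frechet_derivative f (at (y t))) (at (y t))"
      using Suc.prems(2) by (rule C_k_frechet_derivative)
    then have lin: "linear (frechet_derivative f (at (y t)))"
      by (rule has_derivative_linear)
    have "((\<lambda>t. f (y t)) has_vector_derivative frechet_derivative f (at (y t)) (F (y t))) (at t)"
      using vector_derivative_diff_chain_within[OF elim, of f "frechet_derivative f (at (y t))"]
        has_derivative_at_withinI[OF f'] by (simp add: o_def)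
    moreover have "frechet_derivative f (at (y t)) (F (y t))
        = frechet_derivative f (at (y t)) (\<Sum>b\<in>Basis. (F (y t) \<bullet> b) *\<^sub>R b)"
      by (simp add: euclidean_representation)
    moreover have "\<dots> = ?d t"
      using lin by (simp add: linear_sum linear_cmul)
    ultimately show ?case by simp
  qed
  moreover have "smooth_near n t0 ?d"
  proof (intro smooth_near_sum smooth_near_bilinear[OF bounded_bilinear_scaleR]
      smooth_near_bilinear[OF bounded_bilinear_inner] smooth_near_const)
    show "smooth_near n t0 (\<lambda>t. F (y t))"
      using Suc.IH Suc.prems C_k_SucD by blast
    show "smooth_near n t0 (\<lambda>t. frechet_derivative f (at (y t)) b)" for b
      using Suc.IH[of "\<lambda>x. frechet_derivative f (at x) b"] Suc.prems(1,2) C_k_SucD by auto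
  qed
  ultimately show ?case by auto
qed

lemma smooth_near_cong:
  assumes "\<forall>\<^sub>F t in nhds t0. u t = v t" "smooth_near n t0 u"
  shows "smooth_near n t0 v"
proof -
  have ev: "\<forall>\<^sub>F t in nhds t0. \<forall>\<^sub>F x in nhds t. u x = v x"
    using assms(1) by (simp add: eventually_eventually)
  show ?thesis
  proof (cases n)
    case 0
    with assms(2) have "\<forall>\<^sub>F t in nhds t0. isCont u t" by simp
    with ev have "\<forall>\<^sub>F t in nhds t0. isCont v t"
      by eventually_elim (simp add: isCont_cong)
    with 0 show ?thesis by simp
  next
    case (Suc m)
    with assms(2) obtain u' where u': "smooth_near m t0 u'"
      and "\<forall>\<^sub>F t in nhds t0. (u has_vector_derivative u' t) (at t)" by auto
    from this(2) ev have "\<forall>\<^sub>F t in nhds t0. (v has_vector_derivative u' t) (at t)"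
    proof eventually_elim
      case (elim t)
      then show ?case
        using has_vector_derivative_cong_ev[where x = t and f = u and g = v and S = UNIV] eventually_nhds_x_imp_x[of "\<lambda>x. u x = v x" t]
        by auto
    qed
    with u' Suc show ?thesis by auto
  qed
qed

lemma smooth_near_tderiv: "smooth_near (m + n) t0 u \<Longrightarrow> smooth_near n t0 (tderiv m u)"
proof (induction m arbitrary: u)
  case (Suc m)
  then obtain u' where u': "\<forall>\<^sub>F t in nhds t0. (u has_vector_derivative u' t) (at t)"
    and s: "smooth_near (m + n) t0 u'" by auto
  \<comment> \<open>The witness \<open>u'\<close> need agree with \<open>vector_derivative\<close>
    only near \<open>t0\<close>; this suffices because iterated derivatives are local.\<close>
  have "\<forall>\<^sub>F t in nhds t0. u' t = vector_derivative u (at t)"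
    using u' by eventually_elim (rule vector_derivative_at[symmetric])
  then have "\<forall>\<^sub>F t in nhds t0. tderiv m u' t = tderiv (Suc m) u t"
    unfolding tderiv_Suc_shift by (rule tderiv_cong)
  then show ?case
    using Suc.IH[OF s] by (rule smooth_near_cong)
qed simp

text \<open>Vector values rule out a Lagrange remainder, so the mean value inequality takes its
  place: the remainder of \<open>u\<close> has the remainder of \<open>u'\<close> as derivative, and
  each integration gains one power of |h|. The neighbourhood is two-sided because a negative
  abscissa looks back before \<open>t0\<close>.\<close>

lemma Taylor_near:
  fixes u :: "real \<Rightarrow> 'a::euclidean_space"
  assumes "smooth_near n t0 u"
  shows "\<exists>C. \<forall>\<^sub>F h in nhds 0.
    norm (u (t0 + h) - (\<Sum>k<n. (h ^ k / fact k) *\<^sub>R tderiv k u t0)) \<le> C * \<bar>h\<bar> ^ n"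
  using assms
proof (induction n arbitrary: u)
  case 0
  then have "isCont u (t0 + 0)"
    by (auto dest: eventually_nhds_x_imp_x)
  then have "isCont (\<lambda>h. u (t0 + h)) 0"
    by (rule isCont_o2[rotated]) (rule continuous_add[OF continuous_const continuous_ident])
  then have "isCont (\<lambda>h. norm (u (t0 + h))) 0"
    by (rule isCont_norm)
  then have "((\<lambda>h. norm (u (t0 + h))) \<longlongrightarrow> norm (u t0)) (nhds 0)"
    by (simp add: continuous_at tendsto_nhds_iff)
  then have "\<forall>\<^sub>F h in nhds 0. norm (u (t0 + h)) < norm (u t0) + 1"
    by (rule order_tendstoD) simp
  then have "\<forall>\<^sub>F h in nhds 0. norm (u (t0 + h)) \<le> (norm (u t0) + 1) * \<bar>h\<bar> ^ 0"
    by eventually_elim simp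
  then show ?case by auto
next
  case (Suc n)
  then obtain u' where u': "\<forall>\<^sub>F t in nhds t0. (u has_vector_derivative u' t) (at t)"
    and "smooth_near n t0 u'" by auto
  with Suc.IH obtain C where C: "\<forall>\<^sub>F h in nhds 0.
      norm (u' (t0 + h) - (\<Sum>k<n. (h ^ k / fact k) *\<^sub>R tderiv k u' t0)) \<le> C * \<bar>h\<bar> ^ n"
    by blast
  have "\<forall>\<^sub>F t in nhds t0. vector_derivative u (at t) = u' t"
    using u' by eventually_elim (rule vector_derivative_at)
  then have td: "tderiv (Suc k) u t0 = tderiv k u' t0" for k
    using eventually_nhds_x_imp_x[OF tderiv_cong[of "\<lambda>t. vector_derivative u (at t)" u' t0 k]]
    by (simp add: tderiv_Suc_shift)
  define R where "R h = u (t0 + h) - (\<Sum>k<Suc n. (h ^ k / fact k) *\<^sub>R tderiv k u t0)" for h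
  define R' where "R' h = u' (t0 + h) - (\<Sum>k<n. (h ^ k / fact k) *\<^sub>R tderiv k u' t0)" for h
  \<comment> \<open>With the constant term split off, termwise differentiation of the Taylor
    polynomial of \<open>u\<close> yields that of \<open>u'\<close>.\<close>
  have R_eq: "R = (\<lambda>h. u (t0 + h) - (u t0 + (\<Sum>k<n. (h ^ Suc k / fact (Suc k)) *\<^sub>R tderiv k u' t0)))"
    unfolding R_def by (simp add: sum.lessThan_Suc_shift td del: sum.lessThan_Suc power_Suc fact_Suc)
  have dpow: "((\<lambda>h::real. h ^ Suc k / fact (Suc k)) has_real_derivative h ^ k / fact k) (at h)" for k h
  proof -
    have "((\<lambda>h::real. h ^ Suc k / fact (Suc k)) has_real_derivative real (Suc k) * h ^ k / fact (Suc k)) (at h)"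
      by (rule DERIV_cdivide) (use DERIV_pow[of "Suc k" h] in simp)
    then show ?thesis
      by (simp add: fact_Suc del: of_nat_Suc power_Suc)
  qed
  have lim: "filterlim (\<lambda>h. t0 + h) (nhds t0) (nhds 0)"
    using tendsto_add[OF tendsto_const[of t0] tendsto_ident_at[of "0::real" UNIV]]
    by (simp add: tendsto_nhds_iff)
  have "\<forall>\<^sub>F h in nhds 0. (u has_vector_derivative u' (t0 + h)) (at (t0 + h))"
    using u' lim by (rule eventually_compose_filterlim)
  then have "\<forall>\<^sub>F h in nhds 0. (R has_vector_derivative R' h) (at h)"
  proof eventually_elim
    case (elim h)
    have "((\<lambda>h. u (t0 + h)) has_vector_derivative u' (t0 + h)) (at h)"
      using vector_diff_chain_at[of "\<lambda>h. t0 + h" 1 h u "u' (t0 + h)"] elim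
        has_vector_derivative_add[OF has_vector_derivative_const[of t0] has_vector_derivative_id[of "at h"]]
      by (simp add: o_def)
    moreover have "((\<lambda>h. \<Sum>k<n. (h ^ Suc k / fact (Suc k)) *\<^sub>R tderiv k u' t0) has_vector_derivative
        (\<Sum>k<n. (h ^ k / fact k) *\<^sub>R tderiv k u' t0)) (at h)"
    proof (rule has_vector_derivative_sum)
      fix k
      show "((\<lambda>h. (h ^ Suc k / fact (Suc k)) *\<^sub>R tderiv k u' t0) has_vector_derivative
          (h ^ k / fact k) *\<^sub>R tderiv k u' t0) (at h)"
        using has_vector_derivative_scaleR[OF dpow[of k h] has_vector_derivative_const[of "tderiv k u' t0"]]
        by simp
    qed
    ultimately show ?case
      unfolding R_eq R'_def
      using has_vector_derivative_diff has_vector_derivative_add[OF has_vector_derivative_const]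
      by fastforce
  qed
  with C have "\<forall>\<^sub>F h in nhds 0. (R has_vector_derivative R' h) (at h) \<and> norm (R' h) \<le> C * \<bar>h\<bar> ^ n"
    unfolding R'_def[symmetric] by eventually_elim simp
  then obtain e where e: "e > 0" and RR: "\<And>h. \<bar>h\<bar> < e \<Longrightarrow>
      (R has_vector_derivative R' h) (at h) \<and> norm (R' h) \<le> C * \<bar>h\<bar> ^ n"
    unfolding eventually_nhds_metric by (auto simp: dist_real_def)
  have "R 0 = 0"
    by (simp add: R_eq)
  have "norm (R h) \<le> \<bar>C\<bar> * \<bar>h\<bar> ^ Suc n" if h: "\<bar>h\<bar> < e" for h
  proof -
    have "norm (R h - R 0) \<le> (\<bar>C\<bar> * \<bar>h\<bar> ^ n) * norm (h - 0)"
    \<comment> \<open>On the ball of radius |h| the bound on \<open>R' x\<close> is largest at |x| =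
      |h|, which gives a constant valid for all \<open>x\<close>.\<close>
    proof (rule differentiable_bound[where S = "cball 0 \<bar>h\<bar>" and f' = "\<lambda>x a. a *\<^sub>R R' x"])
      fix x :: real assume "x \<in> cball 0 \<bar>h\<bar>"
      then have x: "\<bar>x\<bar> \<le> \<bar>h\<bar>" by simp
      with h RR[of x] show "(R has_derivative (\<lambda>a. a *\<^sub>R R' x)) (at x within cball 0 \<bar>h\<bar>)"
        by (auto simp: has_vector_derivative_def intro: has_derivative_at_withinI)
      have "norm (R' x) \<le> C * \<bar>x\<bar> ^ n"
        using RR[of x] x h by simp
      also have "\<dots> \<le> \<bar>C\<bar> * \<bar>h\<bar> ^ n"
        using x by (intro mult_mono power_mono) auto
      finally have "norm (a *\<^sub>R R' x) \<le> (\<bar>C\<bar> * \<bar>h\<bar> ^ n) * norm a" for a :: real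
        by (simp add: mult.commute mult_left_mono)
      then show "onorm (\<lambda>a. a *\<^sub>R R' x) \<le> \<bar>C\<bar> * \<bar>h\<bar> ^ n"
        by (rule onorm_le)
    qed auto
    with \<open>R 0 = 0\<close> show ?thesis by (simp add: mult_ac)
  qed
  then have "\<forall>\<^sub>F h in nhds 0. norm (R h) \<le> \<bar>C\<bar> * \<bar>h\<bar> ^ Suc n"
    unfolding eventually_nhds_metric using e by (auto simp: dist_real_def)
  then show ?case
    unfolding R_def by blast
qed

section \<open>Derivatives of sums, and Taylor polynomials at points
  \<open>t0 + c * h\<close>\<close>

lemma tderiv_tderiv: "tderiv m (tderiv n u) = tderiv (m + n) u"
  by (simp add: tderiv_def funpow_add)

lemma tderiv_zero [simp]: "tderiv k (\<lambda>t. 0) = (\<lambda>t. 0)"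
  by (induction k) (auto simp: tderiv_Suc)

lemma tderiv_add:
  "smooth_near n t0 u \<Longrightarrow> smooth_near n t0 v \<Longrightarrow> k \<le> n \<Longrightarrow>
    tderiv k (\<lambda>t. u t + v t) t0 = tderiv k u t0 + tderiv k v t0"
proof (induction n arbitrary: k u v)
  case (Suc n)
  from Suc.prems obtain u' v' where
    u': "\<forall>\<^sub>F t in nhds t0. (u has_vector_derivative u' t) (at t)" "smooth_near n t0 u'" and
    v': "\<forall>\<^sub>F t in nhds t0. (v has_vector_derivative v' t) (at t)" "smooth_near n t0 v'"
    by auto
  have uv': "\<forall>\<^sub>F t in nhds t0. vector_derivative u (at t) = u' t"
    "\<forall>\<^sub>F t in nhds t0. vector_derivative v (at t) = v' t"
    by (rule eventually_mono[OF u'(1)], erule vector_derivative_at)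
      (rule eventually_mono[OF v'(1)], erule vector_derivative_at)
  have "\<forall>\<^sub>F t in nhds t0. vector_derivative (\<lambda>t. u t + v t) (at t) = u' t + v' t"
    using u'(1) v'(1)
    by eventually_elim (intro vector_derivative_at has_vector_derivative_add)
  note uv = this uv'
  have "tderiv (Suc j) (\<lambda>t. u t + v t) t0 = tderiv (Suc j) u t0 + tderiv (Suc j) v t0"
    if "j \<le> n" for j
    using Suc.IH[OF u'(2) v'(2) that] uv[THEN tderiv_cong, THEN eventually_nhds_x_imp_x]
    by (simp add: tderiv_Suc_shift)
  with Suc.prems(3) show ?case
    by (cases k) auto
qed simp

lemma Taylor_O_h:
  fixes u :: "real \<Rightarrow> 'a::euclidean_space"
  assumes "smooth_near n t0 u"
  shows "O_h n (\<lambda>h. u (t0 + c * h) - (\<Sum>k<n. (c ^ k / fact k * h ^ k) *\<^sub>R tderiv k u t0))"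
proof -
  obtain C where C: "\<forall>\<^sub>F h in nhds 0.
      norm (u (t0 + h) - (\<Sum>k<n. (h ^ k / fact k) *\<^sub>R tderiv k u t0)) \<le> C * \<bar>h\<bar> ^ n"
    using Taylor_near[OF assms] by blast
  have "((\<lambda>h::real. c * h) \<longlongrightarrow> c * 0) (at_right 0)"
    by (intro tendsto_intros)
  then have "filterlim (\<lambda>h. c * h) (nhds 0) (at_right (0::real))" by simp
  from eventually_compose_filterlim[OF C this]
  have "\<forall>\<^sub>F h in at_right 0. norm (u (t0 + c * h)
      - (\<Sum>k<n. (c ^ k / fact k * h ^ k) *\<^sub>R tderiv k u t0)) \<le> (C * \<bar>c\<bar> ^ n) * h ^ n"
    using eventually_at_right_less
    by eventually_elim (simp add: power_mult_distrib abs_mult mult_ac)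
  then show ?thesis
    using O_h_iff by blast
qed

section \<open>Lipschitz estimates along the stages\<close>

lemma C_k_imp_continuous: "C_k n f \<Longrightarrow> continuous_on UNIV f"
  by (cases n) (auto intro: differentiable_imp_continuous_on)

text \<open>By compactness each directional derivative along a basis vector is bounded on the ball.
  The sum of these bounds dominates the operator norm, and convexity of the ball admits the mean
  value inequality.\<close>

lemma C_k_Lipschitz_on_ball:
  fixes f :: "'a::euclidean_space \<Rightarrow> 'a"
  assumes "C_k (Suc n) f"
  shows "\<exists>L. \<forall>u\<in>cball 0 R. \<forall>v\<in>cball 0 R. norm (f u - f v) \<le> L * norm (u - v)"
proof -
  let ?d = "\<lambda>x. frechet_derivative f (at x)"
  have "\<exists>m. \<forall>x\<in>cball 0 R. norm (?d x b) \<le> m" for b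
  proof -
    have "continuous_on (cball 0 R) (\<lambda>x. ?d x b)"
      using assms C_k_imp_continuous[of n "\<lambda>x. ?d x b"] continuous_on_subset by auto
    then have "bounded ((\<lambda>x. ?d x b) ` cball 0 R)"
      using compact_continuous_image compact_imp_bounded compact_cball by blast
    then show ?thesis
      by (auto simp: bounded_iff)
  qed
  then obtain m where m: "\<And>b x. x \<in> cball 0 R \<Longrightarrow> norm (?d x b) \<le> m b"
    by metis
  have "norm (f u - f v) \<le> (\<Sum>b\<in>Basis. m b) * norm (u - v)"
    if "u \<in> cball 0 R" "v \<in> cball 0 R" for u v
  proof (rule differentiable_bound[OF convex_cball, where f' = ?d])
    fix x :: 'a assume x: "x \<in> cball 0 R"
    have f': "(f has_derivative ?d x) (at x)"
      using assms by (rule C_k_frechet_derivative)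
    then show "(f has_derivative ?d x) (at x within cball 0 R)"
      by (rule has_derivative_at_withinI)
    have lin: "linear (?d x)"
      using f' by (rule has_derivative_linear)
    show "onorm (?d x) \<le> (\<Sum>b\<in>Basis. m b)"
    proof (rule onorm_le)
      fix v
      have "?d x v = ?d x (\<Sum>b\<in>Basis. (v \<bullet> b) *\<^sub>R b)"
        by (simp add: euclidean_representation)
      also have "\<dots> = (\<Sum>b\<in>Basis. (v \<bullet> b) *\<^sub>R ?d x b)"
        using lin by (simp add: linear_sum linear_cmul)
      also have "norm \<dots> \<le> (\<Sum>b\<in>Basis. norm v * m b)"
        using m[OF x] by (intro order_trans[OF norm_sum] sum_mono)
          (auto intro!: mult_mono simp: Basis_le_norm)
      finally show "norm (?d x v) \<le> (\<Sum>b\<in>Basis. m b) * norm v"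
        by (simp add: sum_distrib_left mult.commute)
    qed
  qed (use that in auto)
  then show ?thesis by blast
qed

text \<open>Here the boundedness of the stages demanded by \<open>imex_step\<close> pays off: both
  functions eventually stay in one fixed ball, where a local Lipschitz constant is
  available.\<close>

lemma Lipschitz_along:
  fixes f :: "'a::euclidean_space \<Rightarrow> 'a"
  assumes "C_k (Suc n) f" "O_h 0 u" "O_h 0 v"
  obtains L where "L \<ge> 0" "\<forall>\<^sub>F h in at_right 0. norm (f (u h) - f (v h)) \<le> L * norm (u h - v h)"
proof -
  obtain C D where CD: "\<forall>\<^sub>F h in at_right 0. norm (u h) \<le> C * h ^ 0"
      "\<forall>\<^sub>F h in at_right 0. norm (v h) \<le> D * h ^ 0"
    using assms(2,3) unfolding O_h_iff by blast
  obtain L where L: "\<And>u v. u \<in> cball 0 (max C D) \<Longrightarrow> v \<in> cball 0 (max C D) \<Longrightarrow>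
      norm (f u - f v) \<le> L * norm (u - v)"
    using C_k_Lipschitz_on_ball[OF assms(1)] by blast
  have "\<forall>\<^sub>F h in at_right 0. norm (f (u h) - f (v h)) \<le> \<bar>L\<bar> * norm (u h - v h)"
    using CD
  proof eventually_elim
    case (elim h)
    then have "norm (f (u h) - f (v h)) \<le> L * norm (u h - v h)"
      by (intro L) auto
    also have "\<dots> \<le> \<bar>L\<bar> * norm (u h - v h)"
      by (intro mult_right_mono) auto
    finally show ?case .
  qed
  with that[of "\<bar>L\<bar>"] show ?thesis by simp
qed

lemma O_h_compose:
  fixes f :: "'a::euclidean_space \<Rightarrow> 'a"
  assumes "C_k (Suc n) f" "O_h 0 u" "O_h 0 v" "O_h m (\<lambda>h. u h - v h)"
  shows "O_h m (\<lambda>h. f (u h) - f (v h))"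
proof -
  obtain L where L: "L \<ge> 0" "\<forall>\<^sub>F h in at_right 0. norm (f (u h) - f (v h)) \<le> L * norm (u h - v h)"
    using Lipschitz_along[OF assms(1-3)] .
  obtain C where "\<forall>\<^sub>F h in at_right 0. norm (u h - v h) \<le> C * h ^ m"
    using assms(4) unfolding O_h_iff by blast
  with L(2) have "\<forall>\<^sub>F h in at_right 0. norm (f (u h) - f (v h)) \<le> (L * C) * h ^ m"
  proof eventually_elim
    case (elim h)
    have "L * norm (u h - v h) \<le> L * (C * h ^ m)"
      using elim L(1) by (intro mult_left_mono)
    with elim(1) show ?case by (simp add: mult.assoc)
  qed
  then show ?thesis
    using O_h_iff by blast
qed

text \<open>For small \<open>h\<close> the map \<open>u \<mapsto> u - h l g(u)\<close> expands distances between bounded arguments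
  by a factor of at least \<open>1/2\<close>.\<close>

lemma O_h_implicit:
  fixes g :: "'a::euclidean_space \<Rightarrow> 'a"
  assumes "C_k (Suc n) g" "O_h 0 u" "O_h 0 v"
    and res: "O_h m (\<lambda>h. (u h - (h * l) *\<^sub>R g (u h)) - (v h - (h * l) *\<^sub>R g (v h)))"
  shows "O_h m (\<lambda>h. u h - v h)"
proof -
  obtain L where L: "L \<ge> 0" "\<forall>\<^sub>F h in at_right 0. norm (g (u h) - g (v h)) \<le> L * norm (u h - v h)"
    using Lipschitz_along[OF assms(1-3)] .
  obtain C where C: "\<forall>\<^sub>F h in at_right 0.
      norm ((u h - (h * l) *\<^sub>R g (u h)) - (v h - (h * l) *\<^sub>R g (v h))) \<le> C * h ^ m"
    using res unfolding O_h_iff by blast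
  have "((\<lambda>h::real. h * (\<bar>l\<bar> * L)) \<longlongrightarrow> 0 * (\<bar>l\<bar> * L)) (at_right 0)"
    by (intro tendsto_intros)
  then have "\<forall>\<^sub>F h::real in at_right 0. h * (\<bar>l\<bar> * L) < 1 / 2"
    by (rule order_tendstoD) simp
  with L(2) C have "\<forall>\<^sub>F h in at_right 0. norm (u h - v h) \<le> (2 * C) * h ^ m"
    using eventually_at_right_less
  proof eventually_elim
    case (elim h)
    let ?r = "(u h - (h * l) *\<^sub>R g (u h)) - (v h - (h * l) *\<^sub>R g (v h))"
    have "norm (u h - v h) = norm (?r + (h * l) *\<^sub>R (g (u h) - g (v h)))"
      by (simp add: algebra_simps)
    also have "\<dots> \<le> norm ?r + norm ((h * l) *\<^sub>R (g (u h) - g (v h)))"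
      by (rule norm_triangle_ineq)
    also have "\<dots> \<le> C * h ^ m + norm ((h * l) *\<^sub>R (g (u h) - g (v h)))"
      using elim(2) by simp
    also have "norm ((h * l) *\<^sub>R (g (u h) - g (v h))) \<le> (h * \<bar>l\<bar>) * (L * norm (u h - v h))"
      unfolding norm_scaleR abs_mult using elim(1,4) by (intro mult_mono) auto
    also have "\<dots> = (h * (\<bar>l\<bar> * L)) * norm (u h - v h)"
      by simp
    also have "\<dots> \<le> 1 / 2 * norm (u h - v h)"
      using elim(3) by (intro mult_right_mono) auto
    finally show ?case by simp
  qed
  then show ?thesis
    using O_h_iff by blast
qed

section \<open>The order conditions entry by entry\<close>

text \<open>The entries of \<open>C\<^sub>n K\<^sub>n\<close>; the conditions below are those for \<open>A = a I\<close> and \<open>U = I\<close>, so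
  \<open>a = 0\<close> is the explicit and \<open>a = \<lambda>\<close> the implicit case.\<close>

definition shifted_power :: "real \<Rightarrow> nat \<Rightarrow> real" where
  "shifted_power c k = (if k = 0 then 0 else c ^ (k - 1) / fact (k - 1))"

definition stage_cond :: "real \<Rightarrow> nat \<Rightarrow> real vec \<Rightarrow> real mat \<Rightarrow> bool" where
  "stage_cond a s c W \<longleftrightarrow> (\<forall>i<s. \<forall>k\<le>s.
     W $$ (i, k) = vec_index c i ^ k / fact k - a * shifted_power (vec_index c i) k)"

definition output_cond :: "nat \<Rightarrow> real vec \<Rightarrow> real mat \<Rightarrow> real mat \<Rightarrow> real mat \<Rightarrow> bool" where
  "output_cond s c B V W \<longleftrightarrow> (\<forall>i<s. \<forall>k\<le>s.
     (\<Sum>m\<le>k. W $$ (i, m) / fact (k - m)) =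
     (\<Sum>j<s. B $$ (i, j) * shifted_power (vec_index c j) k) + (\<Sum>j<s. V $$ (i, j) * W $$ (j, k)))"

lemma shifted_power_0 [simp]: "shifted_power c 0 = 0"
  and shifted_power_Suc [simp]: "shifted_power c (Suc k) = c ^ k / fact k"
  by (simp_all add: shifted_power_def)

section \<open>Translation between matrix identities and their entries\<close>

lemma C_mat_carrier: "C_mat c n \<in> carrier_mat (dim_vec c) n"
  by (simp add: C_mat_def)

lemma K_mat_carrier: "K_mat n \<in> carrier_mat n n"
  by (simp add: K_mat_def)

lemma C_mat_index: "i < dim_vec c \<Longrightarrow> k < n \<Longrightarrow> C_mat c n $$ (i, k) = vec_index c i ^ k / fact k"
  by (simp add: C_mat_def)

lemma mult_mat_index:
  "A \<in> carrier_mat m n \<Longrightarrow> B \<in> carrier_mat n q \<Longrightarrow> i < m \<Longrightarrow> k < q \<Longrightarrow>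
    (A * B) $$ (i, k) = (\<Sum>j<n. A $$ (i, j) * B $$ (j, k))"
  by (auto simp: scalar_prod_def lessThan_atLeast0 intro!: sum.cong)

lemma C_mat_K_mat_index:
  assumes "i < dim_vec c" "k < n"
  shows "(C_mat c n * K_mat n) $$ (i, k) = shifted_power (vec_index c i) k"
proof -
  have "(C_mat c n * K_mat n) $$ (i, k) = (\<Sum>j<n. C_mat c n $$ (i, j) * K_mat n $$ (j, k))"
    by (rule mult_mat_index[OF C_mat_carrier K_mat_carrier assms])
  also have "\<dots> = (\<Sum>j<n. if j = k - 1 then shifted_power (vec_index c i) k else 0)"
    using assms by (intro sum.cong) (auto simp: C_mat_index K_mat_def shifted_power_def)
  also have "\<dots> = shifted_power (vec_index c i) k"
    using assms(2) by (subst sum.delta) auto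
  finally show ?thesis .
qed

lemma stage_cond_iff:
  assumes "dim_vec c = s" "W \<in> carrier_mat s (s + 1)"
  shows "stage_cond a s c W \<longleftrightarrow> W = C_mat c (s + 1) - a \<cdot>\<^sub>m (C_mat c (s + 1) * K_mat (s + 1))"
proof -
  let ?R = "C_mat c (s + 1) - a \<cdot>\<^sub>m (C_mat c (s + 1) * K_mat (s + 1))"
  have dims: "dim_row ?R = s" "dim_col ?R = s + 1"
    using assms C_mat_carrier[of c] K_mat_carrier[of "s + 1"] by auto
  have "?R $$ (i, k) = vec_index c i ^ k / fact k - a * shifted_power (vec_index c i) k"
    if "i < s" "k \<le> s" for i k
    using that assms(1) C_mat_carrier[of c "s + 1"] K_mat_carrier[of "s + 1"]
    by (simp add: C_mat_index C_mat_K_mat_index del: index_mult_mat(1))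
  with assms dims show ?thesis
    unfolding stage_cond_def mat_eq_iff by auto
qed

lemma stage_cond_zero_iff:
  assumes "dim_vec c = s" "W \<in> carrier_mat s (s + 1)"
  shows "stage_cond 0 s c W \<longleftrightarrow> W = C_mat c (s + 1)"
  using assms C_mat_carrier[of c "s + 1"]
  by (auto simp: stage_cond_def mat_eq_iff C_mat_index)

section \<open>Powers and exponential of the nilpotent shift\<close>

lemma K_mat_pow: "K_mat n ^\<^sub>m m = mat n n (\<lambda>(i, j). if j = i + m then 1 else 0)"
proof (induction m)
  case 0
  show ?case by (auto simp: K_mat_def mat_eq_iff)
next
  case (Suc m)
  let ?P = "mat n n (\<lambda>(i, j). if j = i + m then 1 else 0 :: real)"
  have "(?P * K_mat n) $$ (i, k) = (if k = i + Suc m then 1 else 0)" if "i < n" "k < n" for i k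
  proof -
    have "(?P * K_mat n) $$ (i, k) = (\<Sum>j<n. ?P $$ (i, j) * K_mat n $$ (j, k))"
      using that by (intro mult_mat_index[of _ n n _ n]) (auto simp: K_mat_carrier)
    also have "\<dots> = (\<Sum>j<n. if j = i + m then (if k = i + Suc m then 1 else 0) else 0)"
      using that by (intro sum.cong) (auto simp: K_mat_def)
    also have "\<dots> = (if k = i + Suc m then 1 else 0)"
      using that by (subst sum.delta) auto
    finally show ?thesis .
  qed
  then show ?case
    unfolding pow_mat.simps Suc
    by (intro eq_matI) (auto simp: carrier_matD[OF K_mat_carrier] simp del: index_mult_mat(1))
qed

lemma E_mat_carrier: "E_mat n \<in> carrier_mat n n"
  by (simp add: E_mat_def mat_exp_def K_mat_def)

lemma E_mat_index:
  assumes "i < n" "j < n"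
  shows "E_mat n $$ (i, j) = (if i \<le> j then 1 / fact (j - i) else 0)"
proof -
  \<comment> \<open>Only the power \<open>m = j - i\<close> can contribute to this entry. For
    \<open>i > j\<close> truncated subtraction gives \<open>m = 0\<close>, and the value assigned
    there is 0 as well.\<close>
  have "(\<lambda>m. (K_mat n ^\<^sub>m m) $$ (i, j) / fact m :: real)
      = (\<lambda>m. if m = j - i then (if i \<le> j then 1 / fact (j - i) else 0) else 0)"
    using assms by (auto simp: K_mat_pow)
  then have "(\<lambda>m. (K_mat n ^\<^sub>m m) $$ (i, j) / fact m :: real) sums
      (if i \<le> j then 1 / fact (j - i) else 0)"
    using sums_single[of "j - i" "\<lambda>_. if i \<le> j then 1 / fact (j - i) else 0 :: real"] by simp
  then show ?thesis
    using assms by (simp add: E_mat_def mat_exp_def K_mat_def sums_iff)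
qed

text \<open>A kernel vector, divided by factorials, would be the coefficient vector of a nonzero
  polynomial of degree below \<open>s\<close> with \<open>s\<close> distinct roots, the abscissae.
  Since \<open>mat_inverse\<close> returns an option, the \<open>Some\<close> in the conclusion is
  what gives meaning to \<open>the (mat_inverse (C_mat c s))\<close>.\<close>

lemma C_mat_inverse:
  assumes "dim_vec c = s" "inj_on (vec_index c) {..<s}"
  obtains D where "mat_inverse (C_mat c s) = Some D" "C_mat c s * D = 1\<^sub>m s"
    "D * C_mat c s = 1\<^sub>m s" "D \<in> carrier_mat s s"
proof -
  have C: "C_mat c s \<in> carrier_mat s s"
    using C_mat_carrier[of c s] assms(1) by simp
  have "det (C_mat c s) \<noteq> 0"
  proof
    assume "det (C_mat c s) = 0"
    then obtain v where v: "v \<in> carrier_vec s" "v \<noteq> 0\<^sub>v s" "C_mat c s *\<^sub>v v = 0\<^sub>v s"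
      using det_0_iff_vec_prod_zero_field[OF C] by auto
    define p where "p = (\<Sum>k<s. monom (vec_index v k / fact k) k)"
    have coeff: "coeff p k = (if k < s then vec_index v k / fact k else 0)" for k
      by (simp add: p_def coeff_sum sum.delta)
    have "p \<noteq> 0"
    proof
      assume "p = 0"
      then have "vec_index v k = 0" if "k < s" for k
        using coeff[of k] that by simp
      with v(1,2) show False by auto
    qed
    have "poly p (vec_index c i) = 0" if i: "i < s" for i
    proof -
      have "0 = vec_index (C_mat c s *\<^sub>v v) i"
        using v(3) i by simp
      also have "\<dots> = (\<Sum>k<s. vec_index c i ^ k / fact k * vec_index v k)"
        using i v(1) C assms(1)
        by (auto simp: scalar_prod_def lessThan_atLeast0 C_mat_index intro!: sum.cong)
      also have "\<dots> = poly p (vec_index c i)"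
        by (simp add: p_def poly_sum poly_monom mult_ac)
      finally show ?thesis by simp
    qed
    then have "vec_index c ` {..<s} \<subseteq> {x. poly p x = 0}" by auto
    then have "card (vec_index c ` {..<s}) \<le> card {x. poly p x = 0}"
      using poly_roots_finite[OF \<open>p \<noteq> 0\<close>] by (rule card_mono[rotated])
    also have "\<dots> \<le> degree p"
      using \<open>p \<noteq> 0\<close> by (rule card_poly_roots_bound)
    finally have "s \<le> degree p"
      using assms(2) by (simp add: card_image)
    then have "lead_coeff p = 0"
      using coeff[of "degree p"] by simp
    with \<open>p \<noteq> 0\<close> show False by simp
  qed
  then have "C_mat c s \<in> Units (ring_mat TYPE(real) s ())"
    by (rule det_non_zero_imp_unit[OF C])
  then obtain D where D: "mat_inverse (C_mat c s) = Some D"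
    using mat_inverse(1)[OF C, where b = "()"] by (cases "mat_inverse (C_mat c s)") auto
  with mat_inverse(2)[OF C D] that show ?thesis by blast
qed

text \<open>By the binomial theorem entry (i, k) of C E is (c_i + 1)^k / k!. Hence \<open>T\<close>
  maps the values of a polynomial of degree below \<open>s\<close> at the abscissae to its values at
  the abscissae shifted by 1. The second equivalence removes the inverse hidden in \<open>T\<close>
  and so brings the formula into the shape in which it meets the order conditions.\<close>

lemma output_weights_iff:
  fixes c :: "real vec" and l :: real and s :: nat
  defines "T \<equiv> C_mat c s * E_mat s * the (mat_inverse (C_mat c s))"
  assumes c: "dim_vec c = s" "inj_on (vec_index c) {..<s}"
    and B: "B \<in> carrier_mat s s" and Bh: "Bh \<in> carrier_mat s s" and V: "V \<in> carrier_mat s s"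
  shows "Bh = B - l \<cdot>\<^sub>m T + l \<cdot>\<^sub>m V \<longleftrightarrow> B = Bh + l \<cdot>\<^sub>m T - l \<cdot>\<^sub>m V"
    and "Bh = B - l \<cdot>\<^sub>m T + l \<cdot>\<^sub>m V \<longleftrightarrow> (\<forall>i<s. \<forall>k<s.
      (\<Sum>j<s. (B $$ (i, j) - Bh $$ (i, j) + l * V $$ (i, j)) * (vec_index c j ^ k / fact k)) =
      l * (\<Sum>m\<le>k. vec_index c i ^ m / fact m / fact (k - m)))"
proof -
  let ?C = "C_mat c s" and ?E = "E_mat s"
  obtain D where D: "mat_inverse ?C = Some D" "?C * D = 1\<^sub>m s" "D * ?C = 1\<^sub>m s" "D \<in> carrier_mat s s"
    using C_mat_inverse[OF c] .
  have C: "?C \<in> carrier_mat s s"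
    using C_mat_carrier[of c s] c(1) by simp
  have CE: "?C * ?E \<in> carrier_mat s s"
    using C E_mat_carrier by auto
  have T: "T = ?C * ?E * D" "T \<in> carrier_mat s s"
    using D CE by (auto simp: T_def)
  \<comment> \<open>\<open>X\<close> is what must equal \<open>l \<cdot>\<^sub>m T\<close>;
    multiplying by the invertible \<open>?C\<close> on the right then loses no information.\<close>
  define X where "X = B - Bh + l \<cdot>\<^sub>m V"
  have X: "X \<in> carrier_mat s s"
    using B Bh V by (auto simp: X_def)
  show "Bh = B - l \<cdot>\<^sub>m T + l \<cdot>\<^sub>m V \<longleftrightarrow> B = Bh + l \<cdot>\<^sub>m T - l \<cdot>\<^sub>m V"
    using B Bh V T(2) by (auto simp: mat_eq_iff algebra_simps)
  have "Bh = B - l \<cdot>\<^sub>m T + l \<cdot>\<^sub>m V \<longleftrightarrow> X = l \<cdot>\<^sub>m T"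
    using B Bh V T(2) by (auto simp: X_def mat_eq_iff algebra_simps)
  also have "\<dots> \<longleftrightarrow> X * ?C = l \<cdot>\<^sub>m (?C * ?E)"
  proof
    assume "X = l \<cdot>\<^sub>m T"
    then have "X * ?C = l \<cdot>\<^sub>m (?C * ?E * (D * ?C))"
      by (simp add: mult_smult_assoc_mat[OF T(2) C])
        (simp add: T(1) assoc_mult_mat[OF CE D(4) C])
    then show "X * ?C = l \<cdot>\<^sub>m (?C * ?E)"
      by (simp only: D(3) right_mult_one_mat[OF CE])
  next
    assume eq: "X * ?C = l \<cdot>\<^sub>m (?C * ?E)"
    have "X = X * ?C * D"
      using X C D(2,4) by (simp add: assoc_mult_mat[OF X C D(4)])
    also have "\<dots> = l \<cdot>\<^sub>m T"
      unfolding eq T(1) using CE D(4) by (simp add: mult_smult_assoc_mat)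
    finally show "X = l \<cdot>\<^sub>m T" .
  qed
  also have "\<dots> \<longleftrightarrow> (\<forall>i<s. \<forall>k<s. (X * ?C) $$ (i, k) = l * (?C * ?E) $$ (i, k))"
    using X C CE by (auto simp: mat_eq_iff simp del: index_mult_mat(1))
  also have "\<dots> \<longleftrightarrow> (\<forall>i<s. \<forall>k<s.
      (\<Sum>j<s. (B $$ (i, j) - Bh $$ (i, j) + l * V $$ (i, j)) * (vec_index c j ^ k / fact k)) =
      l * (\<Sum>m\<le>k. vec_index c i ^ m / fact m / fact (k - m)))"
  proof -
    have "(X * ?C) $$ (i, k) =
        (\<Sum>j<s. (B $$ (i, j) - Bh $$ (i, j) + l * V $$ (i, j)) * (vec_index c j ^ k / fact k))"
      if "i < s" "k < s" for i k
      unfolding mult_mat_index[OF X C that] using that c(1) B Bh V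
      by (intro sum.cong) (auto simp: X_def C_mat_index)
    moreover have "(?C * ?E) $$ (i, k) = (\<Sum>m\<le>k. vec_index c i ^ m / fact m / fact (k - m))"
      if "i < s" "k < s" for i k
    proof -
      have "(?C * ?E) $$ (i, k) = (\<Sum>m<s. ?C $$ (i, m) * ?E $$ (m, k))"
        by (rule mult_mat_index[OF C E_mat_carrier that])
      also have "\<dots> = (\<Sum>m\<le>k. ?C $$ (i, m) * ?E $$ (m, k))"
        using that by (intro sum.mono_neutral_right) (auto simp: E_mat_index)
      also have "\<dots> = (\<Sum>m\<le>k. vec_index c i ^ m / fact m / fact (k - m))"
        using that c(1) by (intro sum.cong) (auto simp: E_mat_index C_mat_index)
      finally show ?thesis .
    qed
    ultimately show ?thesis by simp
  qed
  finally show "Bh = B - l \<cdot>\<^sub>m T + l \<cdot>\<^sub>m V \<longleftrightarrow> (\<forall>i<s. \<forall>k<s.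
      (\<Sum>j<s. (B $$ (i, j) - Bh $$ (i, j) + l * V $$ (i, j)) * (vec_index c j ^ k / fact k)) =
      l * (\<Sum>m\<le>k. vec_index c i ^ m / fact m / fact (k - m)))" .
qed

text \<open>Since \<open>K\<close> commutes with \<open>E\<close>, the difference of the two output conditions is
  \<open>((B - Bh) C - l (C E - V C)) K\<close>.\<close>

lemma output_cond_difference:
  assumes "stage_cond 0 s c W" "stage_cond l s c Wh" "i < s" "k \<le> s"
  shows "((\<Sum>m\<le>k. W $$ (i, m) / fact (k - m))
      - (\<Sum>j<s. B $$ (i, j) * shifted_power (vec_index c j) k) - (\<Sum>j<s. V $$ (i, j) * W $$ (j, k)))
    - ((\<Sum>m\<le>k. Wh $$ (i, m) / fact (k - m))
      - (\<Sum>j<s. Bh $$ (i, j) * shifted_power (vec_index c j) k) - (\<Sum>j<s. V $$ (i, j) * Wh $$ (j, k)))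
    = (if k = 0 then 0 else l * (\<Sum>m\<le>k - 1. vec_index c i ^ m / fact m / fact (k - 1 - m))
      - (\<Sum>j<s. (B $$ (i, j) - Bh $$ (i, j) + l * V $$ (i, j)) *
          (vec_index c j ^ (k - 1) / fact (k - 1))))"
proof -
  have diff: "W $$ (j, m) - Wh $$ (j, m) = l * shifted_power (vec_index c j) m"
    if "j < s" "m \<le> s" for j m
    using assms(1,2) that by (simp add: stage_cond_def)
  have "(\<Sum>m\<le>k. W $$ (i, m) / fact (k - m)) - (\<Sum>m\<le>k. Wh $$ (i, m) / fact (k - m))
      = (\<Sum>m\<le>k. (W $$ (i, m) - Wh $$ (i, m)) / fact (k - m))"
    by (simp add: sum_subtractf diff_divide_distrib)
  also have "\<dots> = (\<Sum>m\<le>k. l * (shifted_power (vec_index c i) m / fact (k - m)))"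
    using assms(3,4) by (intro sum.cong) (simp_all add: diff)
  also have "\<dots> = l * (\<Sum>m\<le>k. shifted_power (vec_index c i) m / fact (k - m))"
    by (simp add: sum_distrib_left)
  \<comment> \<open>The commutation of K and E in entries: C K E on the left, C E K on the right.
    The term \<open>m = 0\<close> vanishes and the rest is reindexed by one.\<close>
  also have "(\<Sum>m\<le>k. shifted_power (vec_index c i) m / fact (k - m)) =
      (if k = 0 then 0 else \<Sum>m\<le>k - 1. vec_index c i ^ m / fact m / fact (k - 1 - m))"
    by (cases k) (simp_all add: sum.atMost_Suc_shift del: sum.atMost_Suc)
  finally have 1: "(\<Sum>m\<le>k. W $$ (i, m) / fact (k - m)) - (\<Sum>m\<le>k. Wh $$ (i, m) / fact (k - m))
      = l * (if k = 0 then 0 else \<Sum>m\<le>k - 1. vec_index c i ^ m / fact m / fact (k - 1 - m))" .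
  have 2: "(\<Sum>j<s. V $$ (i, j) * W $$ (j, k)) - (\<Sum>j<s. V $$ (i, j) * Wh $$ (j, k))
      = (\<Sum>j<s. l * V $$ (i, j) * shifted_power (vec_index c j) k)"
    unfolding sum_subtractf[symmetric] right_diff_distrib[symmetric]
    using assms(4) by (intro sum.cong) (simp_all add: diff)
  have 3: "(\<Sum>j<s. (B $$ (i, j) - Bh $$ (i, j) + l * V $$ (i, j)) * shifted_power (vec_index c j) k)
      = (\<Sum>j<s. B $$ (i, j) * shifted_power (vec_index c j) k)
      - (\<Sum>j<s. Bh $$ (i, j) * shifted_power (vec_index c j) k)
      + (\<Sum>j<s. l * V $$ (i, j) * shifted_power (vec_index c j) k)"
    by (simp only: distrib_right left_diff_distrib sum.distrib sum_subtractf)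
  show ?thesis
    using 1 2 3 by (cases k) simp_all
qed

text \<open>The residuals of the two conditions coincide: at \<open>k = 0\<close> because the first
  column of C K is zero, and at \<open>k > 0\<close> by the weight formula in column
  \<open>k - 1\<close>.\<close>

lemma output_cond_hat_iff:
  assumes W: "stage_cond 0 s c W" and Wh: "stage_cond l s c Wh"
    and eq: "\<forall>i<s. \<forall>k<s.
      (\<Sum>j<s. (B $$ (i, j) - Bh $$ (i, j) + l * V $$ (i, j)) * (vec_index c j ^ k / fact k)) =
      l * (\<Sum>m\<le>k. vec_index c i ^ m / fact m / fact (k - m))"
  shows "output_cond s c B V W \<longleftrightarrow> output_cond s c Bh V Wh"
proof -
  have "(\<Sum>m\<le>k. W $$ (i, m) / fact (k - m))
      - (\<Sum>j<s. B $$ (i, j) * shifted_power (vec_index c j) k) - (\<Sum>j<s. V $$ (i, j) * W $$ (j, k))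
    = (\<Sum>m\<le>k. Wh $$ (i, m) / fact (k - m))
      - (\<Sum>j<s. Bh $$ (i, j) * shifted_power (vec_index c j) k) - (\<Sum>j<s. V $$ (i, j) * Wh $$ (j, k))"
    if "i < s" "k \<le> s" for i k
    using output_cond_difference[OF W Wh that, of B V Bh] eq that by (cases k) simp_all
  then show ?thesis
    unfolding output_cond_def by (smt (verit, best))
qed

text \<open>Both residuals vanish, and column \<open>k + 1\<close> of their difference isolates
  column \<open>k\<close> of the weight formula. Columns 1 to \<open>s\<close> of the conditions
  thus give exactly the columns \<open>k < s\<close>.\<close>

lemma output_conds_imp_weights:
  assumes W: "stage_cond 0 s c W" and Wh: "stage_cond l s c Wh"
    and "output_cond s c B V W" "output_cond s c Bh V Wh" "i < s" "k < s"
  shows "(\<Sum>j<s. (B $$ (i, j) - Bh $$ (i, j) + l * V $$ (i, j)) * (vec_index c j ^ k / fact k)) =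
      l * (\<Sum>m\<le>k. vec_index c i ^ m / fact m / fact (k - m))"
proof -
  have "Suc k \<le> s"
    using \<open>k < s\<close> by simp
  note conds = assms(3,4)[unfolded output_cond_def, rule_format, OF \<open>i < s\<close> this]
  show ?thesis
    using output_cond_difference[OF W Wh \<open>i < s\<close> \<open>Suc k \<le> s\<close>, of B V Bh]
    unfolding conds by simp
qed

section \<open>Expansions in powers of the timestep\<close>

text \<open>Keeps the scalar coefficients \<open>a\<close>, which depend on the method, apart from
  the vectors \<open>U\<close>, which depend on the problem. Linear combinations of stages become
  linear combinations of rows of coefficient matrices.\<close>

definition series :: "nat \<Rightarrow> (nat \<Rightarrow> 'a::euclidean_space) \<Rightarrow> (nat \<Rightarrow> real) \<Rightarrow> real \<Rightarrow> 'a" where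
  "series s U a h = (\<Sum>k\<le>s. (a k * h ^ k) *\<^sub>R U k)"

lemma series_add: "series s U (\<lambda>k. a k + b k) h = series s U a h + series s U b h"
  by (simp add: series_def algebra_simps sum.distrib)

lemma series_diff: "series s U (\<lambda>k. a k - b k) h = series s U a h - series s U b h"
  by (simp add: series_def algebra_simps sum_subtractf)

lemma series_scale: "series s U (\<lambda>k. r * a k) h = r *\<^sub>R series s U a h"
  by (simp add: series_def scaleR_sum_right mult.assoc)

lemma series_sum: "series s U (\<lambda>k. \<Sum>j\<in>J. a j k) h = (\<Sum>j\<in>J. series s U (a j) h)"
  by (simp add: series_def sum_distrib_right scaleR_sum_left sum.swap[of _ J])

lemma series_add_basis: "series s (\<lambda>k. U k + V k) a h = series s U a h + series s V a h"
  by (simp add: series_def scaleR_add_right sum.distrib)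

lemma series_cong:
  "(\<And>k. k \<le> s \<Longrightarrow> a k = b k) \<Longrightarrow> (\<And>k. k \<le> s \<Longrightarrow> U k = V k) \<Longrightarrow> series s U a h = series s V b h"
  by (auto simp: series_def intro!: sum.cong)

lemma series_split: "series s U a h = a 0 *\<^sub>R U 0 + (\<Sum>k=1..s. (a k * h ^ k) *\<^sub>R U k)"
  by (simp add: series_def sum.atMost_shift sum.atLeast1_atMost_eq lessThan_Suc_atMost)

lemma series_const: "series s (\<lambda>k. b) a h = (\<Sum>k\<le>s. a k * h ^ k) *\<^sub>R b"
  by (simp add: series_def scaleR_sum_left)

lemma O_h_Suc_scaleR: "O_h m u \<Longrightarrow> O_h (Suc m) (\<lambda>h. h *\<^sub>R u h)"
  using O_h_power_scaleR[of m u 1] by simp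

lemma series_value:
  assumes "smooth_near (Suc s) t0 u" "\<And>k. k \<le> s \<Longrightarrow> U k = tderiv k u t0"
  shows "O_h (Suc s) (\<lambda>h. u (t0 + c * h) - series s U (\<lambda>k. c ^ k / fact k) h)"
  using Taylor_O_h[OF assms(1), of c] assms(2)
  by (simp add: series_def lessThan_Suc_atMost)

text \<open>Multiplication by \<open>h\<close> moves each Taylor coefficient one place up and leaves
  no constant term; the coefficients become a row of C K instead of C.\<close>

lemma series_shifted_value:
  assumes "smooth_near s t0 u" "\<And>k. k < s \<Longrightarrow> U (Suc k) = tderiv k u t0"
  shows "O_h (Suc s) (\<lambda>h. h *\<^sub>R u (t0 + c * h) - series s U (shifted_power c) h)"
proof -
  have "series s U (shifted_power c) h
      = h *\<^sub>R (\<Sum>k<s. (c ^ k / fact k * h ^ k) *\<^sub>R tderiv k u t0)" for h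
    unfolding series_def sum.atMost_shift
    using assms(2) by (simp add: scaleR_sum_right mult_ac)
  then show ?thesis
    using O_h_Suc_scaleR[OF Taylor_O_h[OF assms(1), of c]] by (simp add: scaleR_diff_right)
qed

text \<open>Re-expanding the derivative of order \<open>m - 1\<close> about \<open>t0\<close>
  produces the coefficients 1 / (k - m)!, that is, row \<open>m\<close> of E.\<close>

lemma series_derivative_value:
  assumes u: "smooth_near s t0 u" and U: "\<And>k. k < s \<Longrightarrow> U (Suc k) = tderiv k u t0"
    and m: "1 \<le> m" "m \<le> s"
  shows "O_h (Suc s) (\<lambda>h. h ^ m *\<^sub>R tderiv (m - 1) u (t0 + h)
    - series s U (\<lambda>k. if m \<le> k then 1 / fact (k - m) else 0) h)"
proof -
  \<comment> \<open>Chosen so that \<open>h ^ m\<close> times a remainder of order \<open>n\<close>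
    is of order \<open>s + 1\<close>; the derivatives consumed are then
    \<open>(m - 1) + n = s\<close> in number.\<close>
  define n where "n = Suc s - m"
  have "smooth_near n t0 (tderiv (m - 1) u)"
    using smooth_near_tderiv[of "m - 1" n t0 u] u m by (simp add: n_def)
  from O_h_power_scaleR[OF Taylor_O_h[OF this, of 1], of m]
  have "O_h (Suc s) (\<lambda>h. h ^ m *\<^sub>R tderiv (m - 1) u (t0 + h)
      - h ^ m *\<^sub>R (\<Sum>k<n. (h ^ k / fact k) *\<^sub>R tderiv k (tderiv (m - 1) u) t0))"
    using m by (simp add: n_def scaleR_diff_right)
  moreover have "h ^ m *\<^sub>R (\<Sum>k<n. (h ^ k / fact k) *\<^sub>R tderiv k (tderiv (m - 1) u) t0)
      = series s U (\<lambda>k. if m \<le> k then 1 / fact (k - m) else 0) h" for h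
  proof -
    have "h ^ m *\<^sub>R (\<Sum>k<n. (h ^ k / fact k) *\<^sub>R tderiv k (tderiv (m - 1) u) t0)
        = (\<Sum>k<n. (1 / fact k * h ^ (k + m)) *\<^sub>R U (k + m))"
    proof (subst scaleR_sum_right, rule sum.cong)
      fix k assume "k \<in> {..<n}"
      then have "k + (m - 1) < s" "k + m = Suc (k + (m - 1))"
        using m by (auto simp: n_def)
      then have "U (k + m) = tderiv (k + (m - 1)) u t0"
        using U by metis
      then show "h ^ m *\<^sub>R ((h ^ k / fact k) *\<^sub>R tderiv k (tderiv (m - 1) u) t0)
          = (1 / fact k * h ^ (k + m)) *\<^sub>R U (k + m)"
        by (simp add: tderiv_tderiv power_add mult_ac)
    qed simp
    also have "\<dots> = (\<Sum>k\<in>{m..s}. (1 / fact (k - m) * h ^ k) *\<^sub>R U k)"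
      using m by (intro sum.reindex_bij_witness[of _ "\<lambda>k. k - m" "\<lambda>k. k + m"]) (auto simp: n_def)
    also have "\<dots> = series s U (\<lambda>k. if m \<le> k then 1 / fact (k - m) else 0) h"
      unfolding series_def by (intro sum.mono_neutral_cong_left) auto
    finally show ?thesis .
  qed
  ultimately show ?thesis by simp
qed

text \<open>The contribution of columns \<open>1\<close> to \<open>s\<close> of the weights to W E.
  Column 0 stays apart because it multiplies \<open>y\<close> itself rather than a derivative of
  \<open>f\<close> or \<open>g\<close> along \<open>y\<close>.\<close>

lemma series_expansion:
  assumes u: "smooth_near s t0 u" and U: "\<And>k. k < s \<Longrightarrow> U (Suc k) = tderiv k u t0"
  shows "O_h (Suc s) (\<lambda>h. (\<Sum>m=1..s. (w m * h ^ m) *\<^sub>R tderiv (m - 1) u (t0 + h))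
    - series s U (\<lambda>k. \<Sum>m=1..k. w m / fact (k - m)) h)"
proof -
  have "O_h (Suc s) (\<lambda>h. \<Sum>m=1..s. w m *\<^sub>R (h ^ m *\<^sub>R tderiv (m - 1) u (t0 + h)
      - series s U (\<lambda>k. if m \<le> k then 1 / fact (k - m) else 0) h))"
    by (intro O_h_sum O_h_scaleR series_derivative_value u U) auto
  moreover have "(\<Sum>m=1..s. w m *\<^sub>R series s U (\<lambda>k. if m \<le> k then 1 / fact (k - m) else 0) h)
      = series s U (\<lambda>k. \<Sum>m=1..k. w m / fact (k - m)) h" for h
    unfolding series_scale[symmetric] series_sum[symmetric]
  proof (rule series_cong)
    fix k assume "k \<le> s"
    then show "(\<Sum>m=1..s. w m * (if m \<le> k then 1 / fact (k - m) else 0)) = (\<Sum>m=1..k. w m / fact (k - m))"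
      by (intro sum.mono_neutral_cong_right) auto
  qed simp
  ultimately show ?thesis
    by (simp add: scaleR_diff_right sum_subtractf)
qed

lemma sum_atMost_split: "(\<Sum>m\<le>k. w m / fact (k - m)) = w 0 / fact k + (\<Sum>m=1..k. w m / fact (k - m) :: real)"
  by (simp add: sum.atMost_shift sum.atLeast1_atMost_eq)

section \<open>Order conditions from the linear test problem\<close>

lemma tderiv_exp: "tderiv k (\<lambda>t. exp t *\<^sub>R b) = (\<lambda>t. exp t *\<^sub>R (b::'a::euclidean_space))"
proof (induction k)
  case (Suc k)
  have "vector_derivative (\<lambda>t. exp t *\<^sub>R b) (at t) = exp t *\<^sub>R b" for t
    by (rule vector_derivative_at) (auto intro!: derivative_eq_intros)
  with Suc show ?case by (simp add: tderiv_Suc)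
qed simp

lemma solves_near_exp: "solves_near (\<lambda>x. x) (\<lambda>t. exp t *\<^sub>R (b::'a::euclidean_space)) t0"
  unfolding solves_near_def by (intro always_eventually allI) (auto intro!: derivative_eq_intros)

text \<open>A diagonal A and U = I decouple the stages: each solves its own equation, with its own
  external stage as input. The parameter \<open>a\<close> lets one argument serve both base
  methods.\<close>

lemma glm_stages_iff:
  assumes "dim_vec (glm_c G) = s" "glm_U G = 1\<^sub>m s"
    and A: "\<And>i j. i < s \<Longrightarrow> j < s \<Longrightarrow> glm_A G $$ (i, j) = (if i = j then a else 0)"
  shows "glm_stages G f h x Y \<longleftrightarrow> (\<forall>i<s. Y i = (h * a) *\<^sub>R f (Y i) + x i)"
proof -
  have "(\<Sum>j<s. glm_A G $$ (i, j) *\<^sub>R f (Y j)) = a *\<^sub>R f (Y i)"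
    and "(\<Sum>j<s. glm_U G $$ (i, j) *\<^sub>R x j) = x i" if i: "i < s" for i
  proof -
    have "(\<Sum>j<s. glm_A G $$ (i, j) *\<^sub>R f (Y j)) = (\<Sum>j<s. if j = i then a *\<^sub>R f (Y j) else 0)"
      using i A by (intro sum.cong) auto
    moreover have "(\<Sum>j<s. glm_U G $$ (i, j) *\<^sub>R x j) = (\<Sum>j<s. if j = i then x j else 0)"
      using i assms(2) by (intro sum.cong) auto
    ultimately show "(\<Sum>j<s. glm_A G $$ (i, j) *\<^sub>R f (Y j)) = a *\<^sub>R f (Y i)"
      "(\<Sum>j<s. glm_U G $$ (i, j) *\<^sub>R x j) = x i"
      using i by (simp_all add: sum.delta)
  qed
  then show ?thesis
    using assms(1,2) by (simp add: glm_stages_def)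
qed

text \<open>For the identity as right-hand side the stage equations are solved in closed form, so
  the definitions of order can be applied to a concrete step. The identity is of class
  \<open>C_k N\<close> for every \<open>N\<close>, hence admissible whatever smoothness bound the
  order supplies.\<close>

lemma glm_order_imp_conds:
  fixes G :: glm
  assumes c: "dim_vec (glm_c G) = s" and U: "glm_U G = 1\<^sub>m s" and V: "glm_V G \<in> carrier_mat s s"
    and A: "\<And>i j. i < s \<Longrightarrow> j < s \<Longrightarrow> glm_A G $$ (i, j) = (if i = j then a else 0)"
    and order: "glm_order TYPE('a::euclidean_space) s G"
    and stage_order: "glm_stage_order TYPE('a) s s G"
  shows "stage_cond a s (glm_c G) (glm_W G)"
    and "output_cond s (glm_c G) (glm_B G) (glm_V G) (glm_W G)"
proof -
  obtain b :: 'a where b: "b \<in> Basis" using nonempty_Basis by blast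
  then have "b \<noteq> 0" by auto
  define y where "y = (\<lambda>t::real. exp t *\<^sub>R b)"
  let ?S = "series s (\<lambda>k. b)"
  \<comment> \<open>The incoming values are the prescribed expansions at time 0 with zero
    remainder.\<close>
  define x where "x h j = ?S (\<lambda>k. glm_W G $$ (j, k)) h" for h j
  \<comment> \<open>The solution of Y = h a Y + x, valid once \<open>h * a < 1\<close>; it converges
    as \<open>h\<close> tends to 0 and hence lies on the bounded branch.\<close>
  define Y where "Y h j = (1 / (1 - h * a)) *\<^sub>R x h j" for h j
  have x0: "(\<lambda>h. x h j) \<midarrow>0\<rightarrow> x 0 j" for j
    unfolding x_def series_def by (intro tendsto_intros)
  have small: "\<forall>\<^sub>F h in at_right 0. 1 - h * a > 0"
  proof -
    have "((\<lambda>h::real. 1 - h * a) \<longlongrightarrow> 1 - 0 * a) (at_right 0)"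
      by (intro tendsto_intros)
    then show ?thesis by (rule order_tendstoD) simp
  qed
  have Y_bounded: "O_h 0 (\<lambda>h. Y h j)" for j
  proof (rule O_h_tendsto)
    have "(\<lambda>h. Y h j) \<midarrow>0\<rightarrow> (1 / (1 - 0 * a)) *\<^sub>R x 0 j"
      unfolding Y_def using x0 by (intro tendsto_intros) auto
    then show "((\<lambda>h. Y h j) \<longlongrightarrow> (1 / (1 - 0 * a)) *\<^sub>R x 0 j) (at_right 0)"
      using tendsto_within_subset by blast
  qed
  have expansion: "glm_expansion s G (\<lambda>x. x) y h t i =
      glm_W G $$ (i, 0) *\<^sub>R y t + (\<Sum>k=1..s. (glm_W G $$ (i, k) * h ^ k) *\<^sub>R tderiv (k - 1) y t)" for h t i
    by (simp add: glm_expansion_def)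
  have td: "tderiv k y t = y t" for k t
    by (simp add: y_def tderiv_exp)
  have "y 0 = b" by (simp add: y_def)
  have x_exp: "x h j = glm_expansion s G (\<lambda>x. x) y h 0 j" for h j
    by (simp add: expansion x_def series_split td \<open>y 0 = b\<close>)
  have step: "glm_step s G (\<lambda>x. x) y 0 x Y"
    unfolding glm_step_def
  proof (intro conjI allI impI Y_bounded)
    show "solves_near (\<lambda>x. x) y 0"
      unfolding y_def by (rule solves_near_exp)
    show "O_h (s + 1) (\<lambda>h. x h j - glm_expansion s G (\<lambda>x. x) y h 0 j)" for j
      by (simp add: x_exp)
    show "\<forall>\<^sub>F h in at_right 0. glm_stages G (\<lambda>x. x) h (x h) (Y h)"
      using small
    proof eventually_elim
      case (elim h)
      then have "(1 - h * a) *\<^sub>R Y h i = x h i" for i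
        by (simp add: Y_def)
      then have "Y h i = (h * a) *\<^sub>R Y h i + x h i" for i
        by (metis add.commute diff_add_cancel scaleR_left_diff_distrib scaleR_one)
      then show ?case
        using glm_stages_iff[OF c U A] by blast
    qed
  qed
  obtain N where N: "\<And>(f :: 'a \<Rightarrow> 'a) y t0 x Y. C_k N f \<and> glm_step s G f y t0 x Y \<longrightarrow>
     (\<forall>i<dim_vec (glm_c G). O_h (s + 1) (\<lambda>h. Y h i - y (t0 + vec_index (glm_c G) i * h)))"
    using stage_order unfolding glm_stage_order_def by blast
  have stage: "O_h (Suc s) (\<lambda>h. Y h i - y (vec_index (glm_c G) i * h))" if "i < s" for i
    using N[of "\<lambda>x. x" y 0 x Y] step C_k_ident that c by auto
  obtain N' where N': "\<And>(f :: 'a \<Rightarrow> 'a) y t0 x Y. C_k N' f \<and> glm_step s G f y t0 x Y \<longrightarrow>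
     (\<forall>i<dim_row (glm_V G).
        O_h (s + 1) (\<lambda>h. glm_output G f h (x h) (Y h) i - glm_expansion s G f y h (t0 + h) i))"
    using order unfolding glm_order_def by blast
  have out: "O_h (Suc s) (\<lambda>h. glm_output G (\<lambda>x. x) h (x h) (Y h) i - glm_expansion s G (\<lambda>x. x) y h h i)"
    if "i < s" for i
    using N'[of "\<lambda>x. x" y 0 x Y] step C_k_ident that V by auto
  have smooth: "smooth_near n 0 y" for n
    using smooth_near_solution[OF solves_near_exp[of b 0] C_k_ident C_k_ident] unfolding y_def by simp
  have val: "O_h (Suc s) (\<lambda>h. y (c * h) - ?S (\<lambda>k. c ^ k / fact k) h)" for c
    using series_value[OF smooth[of "Suc s"], of "\<lambda>k. b" c] by (simp add: td \<open>y 0 = b\<close>)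
  have sval: "O_h (Suc s) (\<lambda>h. h *\<^sub>R y (c * h) - ?S (shifted_power c) h)" for c
    using series_shifted_value[OF smooth[of s], of "\<lambda>k. b" c] by (simp add: td \<open>y 0 = b\<close>)
  have hY: "O_h (Suc s) (\<lambda>h. h *\<^sub>R Y h i - ?S (shifted_power (vec_index (glm_c G) i)) h)" if "i < s" for i
  proof (rule O_h_trans[OF _ sval])
    show "O_h (Suc s) (\<lambda>h. h *\<^sub>R Y h i - h *\<^sub>R y (vec_index (glm_c G) i * h))"
      using O_h_mono[OF O_h_Suc_scaleR[OF stage[OF that]], of "Suc s"] by (simp add: scaleR_diff_right)
  qed
  have zero: "a k = b' k" if "O_h (Suc s) (\<lambda>h. ?S a h - ?S b' h)" "k \<le> s" for a b' k
  proof (rule eq_iff_diff_eq_0[THEN iffD2])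
    have "O_h (Suc s) (\<lambda>h. (\<Sum>k\<le>s. (a k - b' k) * h ^ k) *\<^sub>R b)"
      using that(1)
      by (simp add: series_const left_diff_distrib sum_subtractf scaleR_left_diff_distrib)
    then show "a k - b' k = 0"
      using \<open>b \<noteq> 0\<close> that(2) by (rule polynomial_O_h_imp_zero)
  qed
  show "stage_cond a s (glm_c G) (glm_W G)"
    unfolding stage_cond_def
  proof (intro allI impI)
    fix i k assume i: "i < s" and k: "k \<le> s"
    let ?c = "vec_index (glm_c G) i"
    \<comment> \<open>The stage equation is read backwards as x = Y - h a Y. Stage order supplies
      the expansions of Y and of h Y, which avoids expanding 1 / (1 - h a).\<close>
    have "O_h (Suc s) (\<lambda>h. x h i - ?S (\<lambda>k. ?c ^ k / fact k - a * shifted_power ?c k) h)"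
    proof (rule iffD2[OF O_h_cong])
      show "O_h (Suc s) (\<lambda>h. ((Y h i - y (?c * h)) + (y (?c * h) - ?S (\<lambda>k. ?c ^ k / fact k) h))
          - a *\<^sub>R (h *\<^sub>R Y h i - ?S (shifted_power ?c) h))"
        by (intro O_h_add O_h_diff O_h_scaleR stage val hY i)
      show "\<forall>\<^sub>F h in at_right 0. x h i - ?S (\<lambda>k. ?c ^ k / fact k - a * shifted_power ?c k) h
          = ((Y h i - y (?c * h)) + (y (?c * h) - ?S (\<lambda>k. ?c ^ k / fact k) h))
          - a *\<^sub>R (h *\<^sub>R Y h i - ?S (shifted_power ?c) h)"
        using small
      proof eventually_elim
        case (elim h)
        then have "x h i = (1 - h * a) *\<^sub>R Y h i"
          by (simp add: Y_def)
        then show ?case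
          by (simp add: series_diff series_scale algebra_simps)
      qed
    qed
    then show "glm_W G $$ (i, k) = ?c ^ k / fact k - a * shifted_power ?c k"
      unfolding x_def using zero k by blast
  qed
  show "output_cond s (glm_c G) (glm_B G) (glm_V G) (glm_W G)"
    unfolding output_cond_def
  proof (intro allI impI)
    fix i k assume i: "i < s" and k: "k \<le> s"
    \<comment> \<open>\<open>?b\<close> are the coefficients of the output computed from the stages,
      \<open>?w\<close> those of the expansion it must have at time \<open>h\<close>.\<close>
    let ?b = "\<lambda>k. (\<Sum>j<s. glm_B G $$ (i, j) * shifted_power (vec_index (glm_c G) j) k)
      + (\<Sum>j<s. glm_V G $$ (i, j) * glm_W G $$ (j, k))"
    let ?w = "\<lambda>k. \<Sum>m\<le>k. glm_W G $$ (i, m) / fact (k - m)"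
    have "O_h (Suc s) (\<lambda>h. \<Sum>j<s. glm_B G $$ (i, j) *\<^sub>R
        (h *\<^sub>R Y h j - ?S (shifted_power (vec_index (glm_c G) j)) h))"
      by (intro O_h_sum O_h_scaleR hY) auto
    moreover have "glm_output G (\<lambda>x. x) h (x h) (Y h) i - ?S ?b h =
        (\<Sum>j<s. glm_B G $$ (i, j) *\<^sub>R (h *\<^sub>R Y h j - ?S (shifted_power (vec_index (glm_c G) j)) h))" for h
      using c V by (simp add: glm_output_def series_add series_sum series_scale x_def
          scaleR_diff_right sum_subtractf scaleR_sum_right mult.commute)
    ultimately have o: "O_h (Suc s) (\<lambda>h. glm_output G (\<lambda>x. x) h (x h) (Y h) i - ?S ?b h)"
      by simp
    have "O_h (Suc s) (\<lambda>h. (\<Sum>m=1..s. (glm_W G $$ (i, m) * h ^ m) *\<^sub>R tderiv (m - 1) y (0 + h))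
        - ?S (\<lambda>k. \<Sum>m=1..k. glm_W G $$ (i, m) / fact (k - m)) h)"
      by (rule series_expansion[OF smooth]) (simp add: td \<open>y 0 = b\<close>)
    from O_h_add[OF O_h_scaleR[OF val[of 1], of "glm_W G $$ (i, 0)"] this]
    have "O_h (Suc s) (\<lambda>h. glm_expansion s G (\<lambda>x. x) y h h i - ?S ?w h)"
      unfolding sum_atMost_split series_add expansion
      using series_scale[of s "\<lambda>k. b" "glm_W G $$ (i, 0)" "\<lambda>k. 1 / fact k"]
      by (simp add: algebra_simps)
    with out[OF i] o have "O_h (Suc s) (\<lambda>h. ?S ?w h - ?S ?b h)"
      using O_h_diff[OF O_h_diff[OF o out[OF i]]] by fastforce
    then show "?w k = ?b k"
      using zero k by blast
  qed
qed

section \<open>Sufficiency of the order conditions\<close>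

text \<open>The common leading term with \<open>y t\<close> is booked on the \<open>f\<close> side,
  so \<open>Psi\<close> starts with 0 and each weight matrix acts on a sequence of its own.\<close>

lemma imex_expansion_series:
  assumes "\<And>k. Phi (Suc k) = tderiv k (\<lambda>\<tau>. f (y \<tau>)) t" "\<And>k. Psi (Suc k) = tderiv k (\<lambda>\<tau>. g (y \<tau>)) t"
    and "Phi 0 = y t" "Psi 0 = 0"
  shows "imex_expansion s M f g y h t i =
    series s Phi (\<lambda>k. imex_W M $$ (i, k)) h + series s Psi (\<lambda>k. imex_Wh M $$ (i, k)) h"
proof -
  have "Phi k = tderiv (k - 1) (\<lambda>\<tau>. f (y \<tau>)) t" "Psi k = tderiv (k - 1) (\<lambda>\<tau>. g (y \<tau>)) t"
    if "k \<in> {1..s}" for k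
    using assms(1,2)[of "k - 1"] that by auto
  then show ?thesis
    by (simp add: imex_expansion_def series_split assms(3,4))
qed

lemma imex_stages_iff:
  assumes "is_imex_glm s s s M" "parallel_imex l M" "imex_U M = 1\<^sub>m s"
  shows "imex_stages M f g h x Y \<longleftrightarrow> (\<forall>i<s. Y i = (h * l) *\<^sub>R g (Y i) + x i)"
proof -
  have "Y i = h *\<^sub>R (\<Sum>j<i. imex_A M $$ (i, j) *\<^sub>R f (Y j)) + h *\<^sub>R (\<Sum>j\<le>i. imex_Ah M $$ (i, j) *\<^sub>R g (Y j))
      + (\<Sum>j<dim_col (imex_U M). imex_U M $$ (i, j) *\<^sub>R x j) \<longleftrightarrow> Y i = (h * l) *\<^sub>R g (Y i) + x i"
    if i: "i < s" for i
  proof -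
    have "(\<Sum>j<i. imex_A M $$ (i, j) *\<^sub>R f (Y j)) = 0"
      using i assms by (intro sum.neutral) (auto simp: parallel_imex_def is_imex_glm_def Let_def)
    moreover have "(\<Sum>j\<le>i. imex_Ah M $$ (i, j) *\<^sub>R g (Y j)) = (\<Sum>j\<le>i. if j = i then l *\<^sub>R g (Y j) else 0)"
      using i assms by (intro sum.cong) (auto simp: parallel_imex_def is_imex_glm_def Let_def)
    moreover have "(\<Sum>j<s. imex_U M $$ (i, j) *\<^sub>R x j) = (\<Sum>j<s. if j = i then x j else 0)"
      using i assms(3) by (intro sum.cong) auto
    ultimately show ?thesis
      using i assms(3) by (simp add: sum.delta)
  qed
  moreover have "dim_vec (imex_c M) = s"
    using assms(1) by (auto simp: is_imex_glm_def)
  ultimately show ?thesis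
    unfolding imex_stages_def by simp
qed

text \<open>The value y(t0 + c h) has the same coefficients c^k / k! along \<open>\<Phi>\<close> and
  along \<open>\<Psi>\<close>. Each sequence therefore calls for one stage condition and one output
  condition, the unhatted pair for \<open>\<Phi>\<close> and the hatted pair for
  \<open>\<Psi>\<close>.\<close>

lemma conds_imp_imex_step_order:
  fixes f g :: "'a::euclidean_space \<Rightarrow> 'a"
  assumes M: "is_imex_glm s s s M" "parallel_imex l M" "imex_U M = 1\<^sub>m s"
    and sc: "stage_cond 0 s (imex_c M) (imex_W M)" "stage_cond l s (imex_c M) (imex_Wh M)"
    and oc: "output_cond s (imex_c M) (imex_B M) (imex_V M) (imex_W M)"
      "output_cond s (imex_c M) (imex_Bh M) (imex_V M) (imex_Wh M)"
    and f: "C_k (Suc s) f" and g: "C_k (Suc s) g"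
    and step: "imex_step s M f g y t0 x Y"
    and i: "i < s"
  shows "O_h (Suc s) (\<lambda>h. Y h i - y (t0 + vec_index (imex_c M) i * h))"
    and "O_h (Suc s) (\<lambda>h. imex_output M f g h (x h) (Y h) i - imex_expansion s M f g y h (t0 + h) i)"
proof -
  have c: "dim_vec (imex_c M) = s" and V: "imex_V M \<in> carrier_mat s s"
    and W0: "imex_Wh M $$ (i, 0) = imex_W M $$ (i, 0)"
    using M(1) i by (auto simp: is_imex_glm_def)
  have sol: "solves_near (\<lambda>v. f v + g v) y t0"
    and x: "\<And>j. j < s \<Longrightarrow> O_h (Suc s) (\<lambda>h. x h j - imex_expansion s M f g y h t0 j)"
    and stages: "\<forall>\<^sub>F h in at_right 0. \<forall>i<s. Y h i = (h * l) *\<^sub>R g (Y h i) + x h i"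
    and Y_bounded: "\<And>i. i < s \<Longrightarrow> O_h 0 (\<lambda>h. Y h i)"
    using step c M(3) unfolding imex_step_def imex_stages_iff[OF M] by auto
  define \<phi> where "\<phi> = (\<lambda>t. f (y t))"
  define \<psi> where "\<psi> = (\<lambda>t. g (y t))"
  have fg: "C_k (Suc s) (\<lambda>v. f v + g v)"
    using f g by (rule C_k_add)
  have smooth: "smooth_near (Suc s) t0 \<phi>" "smooth_near (Suc s) t0 \<psi>"
    unfolding \<phi>_def \<psi>_def using smooth_near_solution[OF sol fg] f g by auto
  note smooth' = smooth[THEN smooth_near_SucD]
  have dy: "\<forall>\<^sub>F t in nhds t0. (y has_vector_derivative \<phi> t + \<psi> t) (at t)"
    using sol unfolding solves_near_def \<phi>_def \<psi>_def .
  have smooth_y: "smooth_near (Suc s) t0 y"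
    using dy smooth_near_add[OF smooth'] by auto
  define \<Phi> where "\<Phi> k = (case k of 0 \<Rightarrow> y t0 | Suc k \<Rightarrow> tderiv k \<phi> t0)" for k
  define \<Psi> where "\<Psi> k = (case k of 0 \<Rightarrow> 0 | Suc k \<Rightarrow> tderiv k \<psi> t0)" for k
  have Phi: "\<Phi> (Suc k) = tderiv k \<phi> t0" "\<Psi> (Suc k) = tderiv k \<psi> t0" "\<Phi> 0 = y t0" "\<Psi> 0 = 0" for k
    by (simp_all add: \<Phi>_def \<Psi>_def)
  have tderiv_y: "\<Phi> k + \<Psi> k = tderiv k y t0" if "k \<le> s" for k
  proof (cases k)
    case (Suc m)
    have "\<forall>\<^sub>F t in nhds t0. vector_derivative y (at t) = \<phi> t + \<psi> t"
      using dy by eventually_elim (rule vector_derivative_at)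
    then have "tderiv (Suc m) y t0 = tderiv m (\<lambda>t. \<phi> t + \<psi> t) t0"
      unfolding tderiv_Suc_shift by (rule tderiv_cong[THEN eventually_nhds_x_imp_x])
    then show ?thesis
      using tderiv_add[OF smooth, of m] that Suc by (simp add: Phi)
  qed (simp add: Phi)
  let ?S = "series s \<Phi>" and ?Sh = "series s \<Psi>"
  have y_val: "O_h (Suc s) (\<lambda>h. y (t0 + r * h) - (?S (\<lambda>k. r ^ k / fact k) h + ?Sh (\<lambda>k. r ^ k / fact k) h))" for r
    using series_value[OF smooth_y tderiv_y, of r] by (simp add: series_add_basis)
  have f_val: "O_h (Suc s) (\<lambda>h. h *\<^sub>R f (y (t0 + r * h)) - ?S (shifted_power r) h)" for r
    using series_shifted_value[OF smooth'(1), of \<Phi> r] by (simp add: Phi \<phi>_def)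
  have g_val: "O_h (Suc s) (\<lambda>h. h *\<^sub>R g (y (t0 + r * h)) - ?Sh (shifted_power r) h)" for r
    using series_shifted_value[OF smooth'(2), of \<Psi> r] by (simp add: Phi \<psi>_def)
  have x_val: "O_h (Suc s) (\<lambda>h. x h j
      - (?S (\<lambda>k. imex_W M $$ (j, k)) h + ?Sh (\<lambda>k. imex_Wh M $$ (j, k)) h))" if "j < s" for j
    using x[OF that] imex_expansion_series[of \<Phi> f y t0 \<Psi> g] Phi
    by (simp add: \<phi>_def \<psi>_def)
  have y_bounded: "O_h 0 (\<lambda>h. y (t0 + r * h))" for r
  proof -
    have "smooth_near 0 t0 y"
      using dy by (auto elim!: eventually_mono intro: has_vector_derivative_continuous)
    from Taylor_O_h[OF this, of r] show ?thesis by simp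
  qed
  have stage: "O_h (Suc s) (\<lambda>h. Y h j - y (t0 + vec_index (imex_c M) j * h))" if j: "j < s" for j
  proof (rule O_h_implicit[OF g Y_bounded[OF j] y_bounded])
    let ?c = "vec_index (imex_c M) j"
    let ?e = "\<lambda>k. ?c ^ k / fact k"
    let ?z = "\<lambda>h. y (t0 + ?c * h)"
    have W: "?S (\<lambda>k. imex_W M $$ (j, k)) h = ?S ?e h"
      and Wh: "?Sh (\<lambda>k. imex_Wh M $$ (j, k)) h = ?Sh ?e h - l *\<^sub>R ?Sh (shifted_power ?c) h" for h
      unfolding series_scale[symmetric] series_diff[symmetric]
      using sc j by (intro series_cong; simp add: stage_cond_def)+
    \<comment> \<open>The difference of residuals is regrouped into three expansion errors, those of
      the input, of \<open>y\<close> and of h g(y); the leftover series terms cancel by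
      \<open>W\<close> and \<open>Wh\<close>, which are the stage conditions.\<close>
    show "O_h (Suc s) (\<lambda>h. (Y h j - (h * l) *\<^sub>R g (Y h j)) - (?z h - (h * l) *\<^sub>R g (?z h)))"
    proof (rule iffD2[OF O_h_cong])
      show "O_h (Suc s) (\<lambda>h. (x h j - (?S (\<lambda>k. imex_W M $$ (j, k)) h + ?Sh (\<lambda>k. imex_Wh M $$ (j, k)) h))
          - (?z h - (?S ?e h + ?Sh ?e h)) + l *\<^sub>R (h *\<^sub>R g (?z h) - ?Sh (shifted_power ?c) h))"
        by (intro O_h_add O_h_diff O_h_scaleR x_val y_val g_val j)
      show "\<forall>\<^sub>F h in at_right 0. (Y h j - (h * l) *\<^sub>R g (Y h j)) - (?z h - (h * l) *\<^sub>R g (?z h)) =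
          (x h j - (?S (\<lambda>k. imex_W M $$ (j, k)) h + ?Sh (\<lambda>k. imex_Wh M $$ (j, k)) h))
          - (?z h - (?S ?e h + ?Sh ?e h)) + l *\<^sub>R (h *\<^sub>R g (?z h) - ?Sh (shifted_power ?c) h)"
        using stages
      proof eventually_elim
        case (elim h)
        then have "Y h j - (h * l) *\<^sub>R g (Y h j) = x h j"
          using j by (metis add_diff_cancel_left')
        then show ?case
          by (simp add: W Wh algebra_simps)
      qed
    qed
  qed
  then show "O_h (Suc s) (\<lambda>h. Y h i - y (t0 + vec_index (imex_c M) i * h))"
    using i by blast
  have fY: "O_h (Suc s) (\<lambda>h. h *\<^sub>R f (Y h j) - ?S (shifted_power (vec_index (imex_c M) j)) h)" if "j < s" for j
  proof (rule O_h_trans[OF _ f_val])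
    show "O_h (Suc s) (\<lambda>h. h *\<^sub>R f (Y h j) - h *\<^sub>R f (y (t0 + vec_index (imex_c M) j * h)))"
      using O_h_mono[OF O_h_Suc_scaleR[OF O_h_compose[OF f Y_bounded[OF that] y_bounded stage[OF that]]], of "Suc s"]
      by (simp add: scaleR_diff_right)
  qed
  have gY: "O_h (Suc s) (\<lambda>h. h *\<^sub>R g (Y h j) - ?Sh (shifted_power (vec_index (imex_c M) j)) h)" if "j < s" for j
  proof (rule O_h_trans[OF _ g_val])
    show "O_h (Suc s) (\<lambda>h. h *\<^sub>R g (Y h j) - h *\<^sub>R g (y (t0 + vec_index (imex_c M) j * h)))"
      using O_h_mono[OF O_h_Suc_scaleR[OF O_h_compose[OF g Y_bounded[OF that] y_bounded stage[OF that]]], of "Suc s"]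
      by (simp add: scaleR_diff_right)
  qed
  let ?b = "\<lambda>k. (\<Sum>j<s. imex_B M $$ (i, j) * shifted_power (vec_index (imex_c M) j) k)
    + (\<Sum>j<s. imex_V M $$ (i, j) * imex_W M $$ (j, k))"
  let ?bh = "\<lambda>k. (\<Sum>j<s. imex_Bh M $$ (i, j) * shifted_power (vec_index (imex_c M) j) k)
    + (\<Sum>j<s. imex_V M $$ (i, j) * imex_Wh M $$ (j, k))"
  let ?w = "\<lambda>k. \<Sum>m\<le>k. imex_W M $$ (i, m) / fact (k - m)"
  let ?wh = "\<lambda>k. \<Sum>m\<le>k. imex_Wh M $$ (i, m) / fact (k - m)"
  have "O_h (Suc s) (\<lambda>h.
      (\<Sum>j<s. imex_B M $$ (i, j) *\<^sub>R (h *\<^sub>R f (Y h j) - ?S (shifted_power (vec_index (imex_c M) j)) h))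
      + (\<Sum>j<s. imex_Bh M $$ (i, j) *\<^sub>R (h *\<^sub>R g (Y h j) - ?Sh (shifted_power (vec_index (imex_c M) j)) h))
      + (\<Sum>j<s. imex_V M $$ (i, j) *\<^sub>R (x h j
          - (?S (\<lambda>k. imex_W M $$ (j, k)) h + ?Sh (\<lambda>k. imex_Wh M $$ (j, k)) h))))"
    by (intro O_h_add O_h_sum O_h_scaleR fY gY x_val) auto
  moreover have "imex_output M f g h (x h) (Y h) i - (?S ?b h + ?Sh ?bh h) =
      (\<Sum>j<s. imex_B M $$ (i, j) *\<^sub>R (h *\<^sub>R f (Y h j) - ?S (shifted_power (vec_index (imex_c M) j)) h))
      + (\<Sum>j<s. imex_Bh M $$ (i, j) *\<^sub>R (h *\<^sub>R g (Y h j) - ?Sh (shifted_power (vec_index (imex_c M) j)) h))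
      + (\<Sum>j<s. imex_V M $$ (i, j) *\<^sub>R (x h j
          - (?S (\<lambda>k. imex_W M $$ (j, k)) h + ?Sh (\<lambda>k. imex_Wh M $$ (j, k)) h)))" for h
    using c V by (simp add: imex_output_def series_add series_sum series_scale scaleR_diff_right
        scaleR_add_right sum_subtractf sum.distrib scaleR_sum_right mult.commute)
  ultimately have out: "O_h (Suc s) (\<lambda>h. imex_output M f g h (x h) (Y h) i - (?S ?b h + ?Sh ?bh h))"
    by simp
  \<comment> \<open>The term with y(t0 + h) expands along both \<open>\<Phi>\<close> and
    \<open>\<Psi>\<close>. By \<open>W0\<close> its \<open>\<Psi>\<close> part carries the factor
    that column 0 of \<open>Wh\<close> requires.\<close>
  have "O_h (Suc s) (\<lambda>h. imex_W M $$ (i, 0) *\<^sub>R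
        (y (t0 + 1 * h) - (?S (\<lambda>k. 1 ^ k / fact k) h + ?Sh (\<lambda>k. 1 ^ k / fact k) h))
      + ((\<Sum>m=1..s. (imex_W M $$ (i, m) * h ^ m) *\<^sub>R tderiv (m - 1) \<phi> (t0 + h))
        - ?S (\<lambda>k. \<Sum>m=1..k. imex_W M $$ (i, m) / fact (k - m)) h)
      + ((\<Sum>m=1..s. (imex_Wh M $$ (i, m) * h ^ m) *\<^sub>R tderiv (m - 1) \<psi> (t0 + h))
        - ?Sh (\<lambda>k. \<Sum>m=1..k. imex_Wh M $$ (i, m) / fact (k - m)) h))"
    by (intro O_h_add O_h_scaleR y_val series_expansion smooth' Phi)
  moreover have "imex_expansion s M f g y h (t0 + h) i - (?S ?w h + ?Sh ?wh h) =
      imex_W M $$ (i, 0) *\<^sub>R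
        (y (t0 + 1 * h) - (?S (\<lambda>k. 1 ^ k / fact k) h + ?Sh (\<lambda>k. 1 ^ k / fact k) h))
      + ((\<Sum>m=1..s. (imex_W M $$ (i, m) * h ^ m) *\<^sub>R tderiv (m - 1) \<phi> (t0 + h))
        - ?S (\<lambda>k. \<Sum>m=1..k. imex_W M $$ (i, m) / fact (k - m)) h)
      + ((\<Sum>m=1..s. (imex_Wh M $$ (i, m) * h ^ m) *\<^sub>R tderiv (m - 1) \<psi> (t0 + h))
        - ?Sh (\<lambda>k. \<Sum>m=1..k. imex_Wh M $$ (i, m) / fact (k - m)) h)" for h
    unfolding sum_atMost_split series_add W0
    by (simp add: series_scale[of s _ "imex_W M $$ (i, 0)" "\<lambda>k. 1 / fact k", simplified] imex_expansion_def \<phi>_def \<psi>_def algebra_simps)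
  ultimately have expd: "O_h (Suc s) (\<lambda>h. imex_expansion s M f g y h (t0 + h) i - (?S ?w h + ?Sh ?wh h))"
    by simp
  have "?S ?w h = ?S ?b h" "?Sh ?wh h = ?Sh ?bh h" for h
    using oc i by (intro series_cong; simp add: output_cond_def)+
  with O_h_diff[OF out expd]
  show "O_h (Suc s) (\<lambda>h. imex_output M f g h (x h) (Y h) i - imex_expansion s M f g y h (t0 + h) i)"
    by simp
qed

lemma conds_imp_imex_order:
  assumes "is_imex_glm s s s M" "parallel_imex l M" "imex_U M = 1\<^sub>m s"
    and "stage_cond 0 s (imex_c M) (imex_W M)" "stage_cond l s (imex_c M) (imex_Wh M)"
    and "output_cond s (imex_c M) (imex_B M) (imex_V M) (imex_W M)"
      "output_cond s (imex_c M) (imex_Bh M) (imex_V M) (imex_Wh M)"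
  shows "imex_order TYPE('a::euclidean_space) s M" "imex_stage_order TYPE('a) s s M"
proof -
  have dims: "dim_vec (imex_c M) = s" "dim_row (imex_V M) = s"
    using assms(1) by (auto simp: is_imex_glm_def)
  \<comment> \<open>The class \<open>Suc s\<close> serves all problems at once: it allows Taylor
    expansion up to degree \<open>s\<close> with remainder and, even for \<open>s = 0\<close>,
    contains the C^1 bound behind the Lipschitz estimates.\<close>
  show "imex_order TYPE('a) s M"
    unfolding imex_order_def dims
    using conds_imp_imex_step_order(2)[OF assms] by (intro exI[of _ "Suc s"]) (auto simp del: C_k.simps)
  show "imex_stage_order TYPE('a) s s M"
    unfolding imex_stage_order_def dims
    using conds_imp_imex_step_order(1)[OF assms] by (intro exI[of _ "Suc s"]) (auto simp del: C_k.simps)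
qed

section \<open>The base methods as special cases of the IMEX method\<close>

lemma explicit_base_simps [simp]:
  "glm_c (explicit_base M) = imex_c M" "glm_A (explicit_base M) = imex_A M"
  "glm_B (explicit_base M) = imex_B M" "glm_U (explicit_base M) = imex_U M"
  "glm_V (explicit_base M) = imex_V M" "glm_W (explicit_base M) = imex_W M"
  by (simp_all add: explicit_base_def)

lemma implicit_base_simps [simp]:
  "glm_c (implicit_base M) = imex_c M" "glm_A (implicit_base M) = imex_Ah M"
  "glm_B (implicit_base M) = imex_Bh M" "glm_U (implicit_base M) = imex_U M"
  "glm_V (implicit_base M) = imex_V M" "glm_W (implicit_base M) = imex_Wh M"
  by (simp_all add: implicit_base_def)

lemma explicit_base_stages_iff:
  assumes "is_imex_glm s s s M" "parallel_imex l M" "imex_U M = 1\<^sub>m s"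
  shows "glm_stages (explicit_base M) f h x Y \<longleftrightarrow> (\<forall>i<s. Y i = (h * 0) *\<^sub>R f (Y i) + x i)"
  by (rule glm_stages_iff) (use assms in \<open>auto simp: is_imex_glm_def parallel_imex_def Let_def\<close>)

lemma implicit_base_stages_iff:
  assumes "is_imex_glm s s s M" "parallel_imex l M" "imex_U M = 1\<^sub>m s"
  shows "glm_stages (implicit_base M) f h x Y \<longleftrightarrow> (\<forall>i<s. Y i = (h * l) *\<^sub>R f (Y i) + x i)"
  by (rule glm_stages_iff) (use assms in \<open>auto simp: is_imex_glm_def parallel_imex_def Let_def\<close>)

lemma explicit_base_expansion:
  "glm_expansion p (explicit_base M) f y h t i = imex_expansion p M f (\<lambda>_. 0) y h t i"
  by (simp add: glm_expansion_def imex_expansion_def)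

text \<open>The IMEX expansion takes its leading coefficient from \<open>W\<close>, the base method
  from \<open>Wh\<close>; they agree in the rows \<open>i < r\<close>.\<close>

lemma implicit_base_expansion:
  assumes "is_imex_glm s r p M" "i < r"
  shows "glm_expansion p (implicit_base M) g y h t i = imex_expansion p M (\<lambda>_. 0) g y h t i"
  using assms by (simp add: glm_expansion_def imex_expansion_def is_imex_glm_def)

text \<open>With \<open>g = 0\<close> the implicit term drops out and the stages are just the
  inputs, exactly as for the explicit base method with A = 0.\<close>

lemma explicit_base_step:
  assumes M: "is_imex_glm s s s M" "parallel_imex l M" "imex_U M = 1\<^sub>m s"
  shows "glm_step s (explicit_base M) f y t0 x Y \<longleftrightarrow> imex_step s M f (\<lambda>_. 0) y t0 x Y"
  unfolding glm_step_def imex_step_def imex_stages_iff[OF M] explicit_base_stages_iff[OF M]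
  by (simp add: explicit_base_expansion)

lemma implicit_base_step:
  assumes M: "is_imex_glm s s s M" "parallel_imex l M" "imex_U M = 1\<^sub>m s"
  shows "glm_step s (implicit_base M) g y t0 x Y \<longleftrightarrow> imex_step s M (\<lambda>_. 0) g y t0 x Y"
  unfolding glm_step_def imex_step_def imex_stages_iff[OF M] implicit_base_stages_iff[OF M]
  using M(3) by (simp add: implicit_base_expansion[OF M(1)])

text \<open>The zero map is of class \<open>C_k N\<close> for every \<open>N\<close>, so it is an
  admissible partner and the smoothness bound is inherited.\<close>

lemma imex_order_imp_explicit_base:
  assumes M: "is_imex_glm s s s M" "parallel_imex l M" "imex_U M = 1\<^sub>m s"
  shows "imex_order TYPE('a::euclidean_space) s M \<Longrightarrow> glm_order TYPE('a) s (explicit_base M)"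
    and "imex_stage_order TYPE('a) s s M \<Longrightarrow> glm_stage_order TYPE('a) s s (explicit_base M)"
proof -
  have out: "glm_output (explicit_base M) f h x Y i = imex_output M f (\<lambda>_. 0) h x Y i"
    for f :: "'a \<Rightarrow> 'a" and h x Y i
    by (simp add: glm_output_def imex_output_def)
  show "glm_order TYPE('a) s (explicit_base M)" if "imex_order TYPE('a) s M"
    using that unfolding imex_order_def glm_order_def explicit_base_step[OF M]
      explicit_base_expansion out explicit_base_simps
    using C_k_const by blast
  show "glm_stage_order TYPE('a) s s (explicit_base M)" if "imex_stage_order TYPE('a) s s M"
    using that unfolding imex_stage_order_def glm_stage_order_def explicit_base_step[OF M]
      explicit_base_simps
    using C_k_const by blast
qed

lemma imex_order_imp_implicit_base:
  assumes M: "is_imex_glm s s s M" "parallel_imex l M" "imex_U M = 1\<^sub>m s"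
  shows "imex_order TYPE('a::euclidean_space) s M \<Longrightarrow> glm_order TYPE('a) s (implicit_base M)"
    and "imex_stage_order TYPE('a) s s M \<Longrightarrow> glm_stage_order TYPE('a) s s (implicit_base M)"
proof -
  have out: "glm_output (implicit_base M) g h x Y i = imex_output M (\<lambda>_. 0) g h x Y i"
    for g :: "'a \<Rightarrow> 'a" and h x Y i
    by (simp add: glm_output_def imex_output_def)
  have V: "dim_row (imex_V M) = s"
    using M(1) by (auto simp: is_imex_glm_def)
  show "glm_order TYPE('a) s (implicit_base M)" if order: "imex_order TYPE('a) s M"
  proof -
    obtain N where N: "\<And>(f :: 'a \<Rightarrow> 'a) g y t0 x Y. C_k N f \<and> C_k N g \<and> imex_step s M f g y t0 x Y \<longrightarrow>
        (\<forall>i<s. O_h (s + 1) (\<lambda>h. imex_output M f g h (x h) (Y h) i - imex_expansion s M f g y h (t0 + h) i))"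
      using order V unfolding imex_order_def by auto
    show ?thesis
      unfolding glm_order_def implicit_base_step[OF M] out implicit_base_simps V
    \<comment> \<open>The index \<open>i\<close> is fixed before rewriting, since the expansions are
      known to agree only for \<open>i < s\<close>.\<close>
    proof (intro exI[of _ N] allI impI)
      fix g :: "'a \<Rightarrow> 'a" and y t0 x Y i
      assume "C_k N g \<and> imex_step s M (\<lambda>_. 0) g y t0 x Y" and i: "i < s"
      then show "O_h (s + 1) (\<lambda>h. imex_output M (\<lambda>_. 0) g h (x h) (Y h) i
          - glm_expansion s (implicit_base M) g y h (t0 + h) i)"
        unfolding implicit_base_expansion[OF M(1) i] using N C_k_const by blast
    qed
  qed
  show "glm_stage_order TYPE('a) s s (implicit_base M)" if "imex_stage_order TYPE('a) s s M"
    using that unfolding imex_stage_order_def glm_stage_order_def implicit_base_step[OF M]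
      implicit_base_simps
    using C_k_const by blast
qed

theorem theorem3p1:
  fixes M :: imex_glm and s :: nat and l :: real
  assumes "is_imex_glm s s s M"
    and "nonconfluent M"
    and "parallel_imex l M"
    and "imex_U M = 1\<^sub>m s"
  shows
    "((imex_order TYPE('a::euclidean_space) s M \<and> imex_stage_order TYPE('a) s s M) \<longleftrightarrow>
      (glm_order TYPE('a) s (explicit_base M) \<and> glm_stage_order TYPE('a) s s (explicit_base M) \<and>
       imex_Wh M = C_mat (imex_c M) (s + 1) - l \<cdot>\<^sub>m (C_mat (imex_c M) (s + 1) * K_mat (s + 1)) \<and>
       imex_Bh M = imex_B M - l \<cdot>\<^sub>m (C_mat (imex_c M) s * E_mat s * the (mat_inverse (C_mat (imex_c M) s)))
                   + l \<cdot>\<^sub>m imex_V M))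
     \<and>
     ((imex_order TYPE('a) s M \<and> imex_stage_order TYPE('a) s s M) \<longleftrightarrow>
      (glm_order TYPE('a) s (implicit_base M) \<and> glm_stage_order TYPE('a) s s (implicit_base M) \<and>
       imex_W M = C_mat (imex_c M) (s + 1) \<and>
       imex_B M = imex_Bh M + l \<cdot>\<^sub>m (C_mat (imex_c M) s * E_mat s * the (mat_inverse (C_mat (imex_c M) s)))
                  - l \<cdot>\<^sub>m imex_V M))"
proof -
  note M = assms(1,3,4)
  have dims: "dim_vec (imex_c M) = s" "imex_W M \<in> carrier_mat s (s + 1)"
      "imex_Wh M \<in> carrier_mat s (s + 1)" "imex_V M \<in> carrier_mat s s"
      "imex_B M \<in> carrier_mat s s" "imex_Bh M \<in> carrier_mat s s"
    using assms(1) by (auto simp: is_imex_glm_def)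
  have A: "imex_A M $$ (i, j) = (if i = j then 0 else 0)" "imex_Ah M $$ (i, j) = (if i = j then l else 0)"
    if "i < s" "j < s" for i j
    using assms(3) dims(1) that by (auto simp: parallel_imex_def Let_def)
  have inj: "inj_on (vec_index (imex_c M)) {..<s}"
    using assms(2) dims(1) by (simp add: nonconfluent_def)
  note weights = output_weights_iff[OF dims(1) inj dims(5,6,4), of l]
  let ?sc = "stage_cond 0 s (imex_c M) (imex_W M)"
  let ?sch = "stage_cond l s (imex_c M) (imex_Wh M)"
  let ?oc = "output_cond s (imex_c M) (imex_B M) (imex_V M) (imex_W M)"
  let ?och = "output_cond s (imex_c M) (imex_Bh M) (imex_V M) (imex_Wh M)"
  let ?imex = "imex_order TYPE('a) s M \<and> imex_stage_order TYPE('a) s s M"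
  let ?ex = "glm_order TYPE('a) s (explicit_base M) \<and> glm_stage_order TYPE('a) s s (explicit_base M)"
  let ?im = "glm_order TYPE('a) s (implicit_base M) \<and> glm_stage_order TYPE('a) s s (implicit_base M)"
  let ?weights = "\<forall>i<s. \<forall>k<s. (\<Sum>j<s. (imex_B M $$ (i, j) - imex_Bh M $$ (i, j) + l * imex_V M $$ (i, j)) *
      (vec_index (imex_c M) j ^ k / fact k)) =
    l * (\<Sum>m\<le>k. vec_index (imex_c M) i ^ m / fact m / fact (k - m))"
  have ex: "?sc \<and> ?oc" if ?ex
    using glm_order_imp_conds[where 'a = 'a and G = "explicit_base M" and s = s and a = 0] that dims(1,4) assms(4) A by simp
  have im: "?sch \<and> ?och" if ?im
    using glm_order_imp_conds[where 'a = 'a and G = "implicit_base M" and s = s and a = l] that dims(1,4) assms(4) A by simp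
  \<comment> \<open>Forwards, each base method inherits its order through a zero partner and yields
    one pair of conditions; backwards, all four enter the Taylor argument for the coupled
    problem.\<close>
  have imex: "?imex \<longleftrightarrow> ?sc \<and> ?sch \<and> ?oc \<and> ?och"
    using conds_imp_imex_order[OF M] ex im imex_order_imp_explicit_base[OF M]
      imex_order_imp_implicit_base[OF M] by blast
  have hat: "?oc \<longleftrightarrow> ?och" if ?sc ?sch ?weights
    using that by (rule output_cond_hat_iff)
  have necessary: ?weights if ?sc ?sch ?oc ?och
    using output_conds_imp_weights[OF that] by blast
  \<comment> \<open>From right to left, \<open>?ex\<close> gives \<open>?sc\<close> and
    \<open>?oc\<close>, the closed form of \<open>Wh\<close> is \<open>?sch\<close>, and the weight
    formula carries \<open>?oc\<close> over to the missing \<open>?och\<close>. The implicit case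
    below is the mirror image.\<close>
  have "?imex \<longleftrightarrow> ?ex \<and> ?sch \<and> ?weights"
    using imex ex hat necessary imex_order_imp_explicit_base[OF M] by blast
  moreover have "?imex \<longleftrightarrow> ?im \<and> ?sc \<and> ?weights"
    using imex im hat necessary imex_order_imp_implicit_base[OF M] by blast
  ultimately show ?thesis
    unfolding stage_cond_iff[OF dims(1,3)] stage_cond_zero_iff[OF dims(1,2)]
      weights(2)[symmetric] weights(1)[symmetric] by simp
qed

end
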